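(* Let $(M,g)$ be a Lorentz surface and let $(N,g_N,D,h,J,\tilde R)$ be Lorentzian Kaehler surface data along $M$ (as defined in the context). Suppose that at every point of $M$ the equation of Gauss $$R(X,Y;Z,W)=\tilde R(X,Y;Z,W)+\langle h(X,W),h(Y,Z)\rangle-\langle h(X,Z),h(Y,W)\rangle$$ and the equation of Codazzi $$(\tilde R(X,Y)Z)^{\perp}=(\bar\nabla_X h)(Y,Z)-(\bar\nabla_Y h)(X,Z)$$ hold for all vectors $X,Y,Z,W$ tangent to $M$. Then the equation of Ricci $$\tilde g(R^D(X,Y)\xi,\eta)=\tilde R(X,Y;\xi,\eta)+g([A_\xi,A_\eta]X,Y)$$ holds at every point of $M$ for all $X,Y$ tangent to $M$ and all $\xi,\eta\in N$.
   Context: All objects are smooth. A Lorentz surface $(M,g)$ is a real 2-dimensional manifold $M$ with a pseudo-Riemannian metric $g$ of signature $(1,1)$; $\nabla$ is its Levi-Civita connection and $R$ its curvature tensor. Curvature convention for any connection $\nabla'$: $R'(X,Y)=\nabla'_X\nabla'_Y-\nabla'_Y\nabla'_X-\nabla'_{[X,Y]}$; also $R(X,Y;Z,W)=g(R(X,Y)Z,W)$. A Lorentzian Kaehler surface is a complex 2-dimensional manifold with almost complex structure $J$ and pseudo-Riemannian metric $\tilde g$ of real signature $(2,2)$ (complex index one), with $\tilde g(JX,JY)=\tilde g(X,Y)$ and $\tilde\nabla J=0$ for the Levi-Civita connection $\tilde\nabla$ of $\tilde g$. "Lorentzian Kaehler surface data along $M$" means the data that a Lorentz surface in a Lorentzian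 Kaehler surface carries, with the three fundamental equations not assumed: (i) a real rank-2 vector bundle $N\to M$ (the normal bundle) with a fibre metric $g_N$ of signature $(1,1)$, and a connection $D$ on $N$ compatible with $g_N$ (the normal connection), with curvature $R^D$; (ii) a symmetric bilinear bundle map $h:TM\times TM\to N$ (the second fundamental form). Put $E=TM\oplus N$ with fibre metric $\tilde g=\langle\cdot,\cdot\rangle=g\oplus g_N$, so $TM$ and $N$ are orthogonal; $(\cdot)^\perp$ denotes the $N$-component. For $\xi\in N$ the shape operator $A_\xi$ is defined by $g(A_\xi X,Y)=\tilde g(h(X,Y),\xi)$. Define the connection $\tilde\nabla$ on $E$ by the formulas of Gauss and Weingarten: $\tilde\nabla_XY=\nabla_XY+h(X,Y)$ and $\tilde\nabla_X\xi=-A_\xi X+D_X\xi$, for $X,Y$ tangent to $M$ and $\xi$ a section of $N$; (iii) a bundle endomorphism $J:E\to E$ with $J^2=-\mathrm{Id}$, $\tilde g(J\sigma,J\tau)=\tilde g(\sigma,\tau)$ for all $\sigma,\tau$, and $\tilde\nabla_X(J\sigma)=J\tilde\nabla_X\sigma$ for all tangent $X$ and all sections $\sigma$ of $E$; (iv) a 4-linear tensor $\tilde R(\cdot,\cdot;\cdot,\cdot)$ on the fibres of $E$ (playing the role of the ambient curvature tensor along $M$) satisfying, for all $X,Y,Z,W\in E$ at the same point, $$\tilde R(X,Y;Z,W)=-\tilde R(Y,X;Z,W),\quad \tilde R(X,Y;Z,W)=\tilde R(Z,W;X,Y),\quad \tilde R(X,Y;JZ,W)=-\tilde R(X,Y;Z,JW);$$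 the vector $\tilde R(X,Y)Z\in E$ is defined by $\tilde g(\tilde R(X,Y)Z,W)=\tilde R(X,Y;Z,W)$. The covariant derivative of $h$ is $(\bar\nabla_Xh)(Y,Z)=D_Xh(Y,Z)-h(\nabla_XY,Z)-h(Y,\nabla_XZ)$. *)

theory Defs
  imports "HOL-Analysis.Analysis" "HOL-Library.Function_Algebras"
begin

(* Pointwise real vector space structure on functions; tangent vectors are functionals on functions. *)
instantiation "fun" :: (type, real_vector) real_vector
begin

definition scaleR_fun :: "real \<Rightarrow> ('a \<Rightarrow> 'b) \<Rightarrow> 'a \<Rightarrow> 'b"
  where "scaleR_fun r f = (\<lambda>x. r *\<^sub>R f x)"

instance
  by standard (auto simp: scaleR_fun_def fun_eq_iff scaleR_add_right scaleR_add_left)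

end


section \<open>Smooth surfaces\<close>

(* Intended for open S, where it is the usual C^k: all directional derivatives are C^(k-1). *)
primrec Ck_on :: "nat \<Rightarrow> 'a::euclidean_space set \<Rightarrow> ('a \<Rightarrow> 'b::real_normed_vector) \<Rightarrow> bool"
  where
    "Ck_on 0 S f \<longleftrightarrow> continuous_on S f"
  | "Ck_on (Suc k) S f \<longleftrightarrow>
       (\<forall>x\<in>S. f differentiable (at x)) \<and> (\<forall>v. Ck_on k S (\<lambda>x. frechet_derivative f (at x) v))"

definition smooth_on :: "'a::euclidean_space set \<Rightarrow> ('a \<Rightarrow> 'b::real_normed_vector) \<Rightarrow> bool"
  where "smooth_on S f \<longleftrightarrow> (\<forall>k. Ck_on k S f)"

(* A chart is given by its domain and its coordinate map. *)
type_synonym 'm chart = "'m set \<times> ('m \<Rightarrow> real^2)"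

definition smooth_map_on ::
  "'m chart set \<Rightarrow> 'm set \<Rightarrow> ('m \<Rightarrow> 'b::real_normed_vector) \<Rightarrow> bool"
  where "smooth_map_on M W f \<longleftrightarrow>
    (\<forall>(U, \<phi>)\<in>M. smooth_on (\<phi> ` (U \<inter> W)) (f \<circ> inv_into U \<phi>))"

(* A smooth surface is a Hausdorff, second countable type 'm together with an atlas M.
   The last clause says that all transition maps are smooth. *)
definition smooth_surface :: "'m::{t2_space, second_countable_topology} chart set \<Rightarrow> bool"
  where "smooth_surface M \<longleftrightarrow>
    (\<Union>(U, \<phi>)\<in>M. U) = UNIV \<and>
    (\<forall>(U, \<phi>)\<in>M. open U \<and> open (\<phi> ` U) \<and> homeomorphism U (\<phi> ` U) \<phi> (inv_into U \<phi>)) \<and>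
    (\<forall>(U, \<phi>)\<in>M. smooth_map_on M U \<phi>)"

definition smooth_functions :: "'m chart set \<Rightarrow> ('m \<Rightarrow> real) set"
  where "smooth_functions M = {f. smooth_map_on M UNIV f}"

type_synonym 'm tvec = "('m \<Rightarrow> real) \<Rightarrow> real"

(* Derivations of the algebra of smooth functions at p. Functionals are total in HOL; the last
   clause fixes the (irrelevant) values on non-smooth functions, so that equality of tangent
   vectors is equality of derivations. *)
definition tangent_space :: "'m chart set \<Rightarrow> 'm \<Rightarrow> 'm tvec set"
  where "tangent_space M p = {v.
    (\<forall>f\<in>smooth_functions M. \<forall>g\<in>smooth_functions M. \<forall>a b.
       v (\<lambda>q. a * f q + b * g q) = a * v f + b * v g) \<and>
    (\<forall>f\<in>smooth_functions M. \<forall>g\<in>smooth_functions M.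
       v (\<lambda>q. f q * g q) = v f * g p + f p * v g) \<and>
    (\<forall>f. f \<notin> smooth_functions M \<longrightarrow> v f = 0)}"

definition vector_fields :: "'m chart set \<Rightarrow> ('m \<Rightarrow> 'm tvec) set"
  where "vector_fields M = {X. (\<forall>p. X p \<in> tangent_space M p) \<and>
    (\<forall>f\<in>smooth_functions M. (\<lambda>p. X p f) \<in> smooth_functions M)}"

definition lie_bracket :: "('m \<Rightarrow> 'm tvec) \<Rightarrow> ('m \<Rightarrow> 'm tvec) \<Rightarrow> 'm \<Rightarrow> 'm tvec"
  where "lie_bracket X Y p = (\<lambda>f. X p (\<lambda>q. Y q f) - Y p (\<lambda>q. X q f))"


section \<open>Rank 2 vector bundles\<close>

(* The fibres N p are linear subspaces of a fixed real vector space 'v; the smooth structure is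
   given by a family T of local trivializations. (V, \<tau>) in T parametrizes the fibre over each
   p in V by a linear isomorphism \<tau> p from real^2 onto N p. *)
type_synonym ('m, 'v) trivialization = "'m set \<times> ('m \<Rightarrow> real^2 \<Rightarrow> 'v)"

definition rank2_bundle ::
  "'m::topological_space chart set \<Rightarrow> ('m \<Rightarrow> 'v::real_vector set) \<Rightarrow> ('m, 'v) trivialization set \<Rightarrow> bool"
  where "rank2_bundle M N T \<longleftrightarrow>
    (\<Union>(V, \<tau>)\<in>T. V) = UNIV \<and>
    (\<forall>(V, \<tau>)\<in>T. open V \<and> (\<forall>p\<in>V. linear (\<tau> p) \<and> inj (\<tau> p) \<and> range (\<tau> p) = N p)) \<and>
    (\<forall>(V, \<tau>)\<in>T. \<forall>(V', \<tau>')\<in>T. \<forall>c. smooth_map_on M (V \<inter> V') (\<lambda>p. inv (\<tau>' p) (\<tau> p c)))"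

definition bundle_sections ::
  "'m chart set \<Rightarrow> ('m \<Rightarrow> 'v set) \<Rightarrow> ('m, 'v) trivialization set \<Rightarrow> ('m \<Rightarrow> 'v) set"
  where "bundle_sections M N T = {s. (\<forall>p. s p \<in> N p) \<and>
    (\<forall>(V, \<tau>)\<in>T. smooth_map_on M V (\<lambda>p. inv (\<tau> p) (s p)))}"


section \<open>Fibre metrics and connections\<close>

definition linear_on :: "'v::real_vector set \<Rightarrow> ('v \<Rightarrow> 'w::real_vector) \<Rightarrow> bool"
  where "linear_on V f \<longleftrightarrow>
    (\<forall>x\<in>V. \<forall>y\<in>V. f (x + y) = f x + f y) \<and> (\<forall>x\<in>V. \<forall>c. f (c *\<^sub>R x) = c *\<^sub>R f x)"

definition bilinear_on :: "'v::real_vector set \<Rightarrow> ('v \<Rightarrow> 'v \<Rightarrow> 'w::real_vector) \<Rightarrow> bool"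
  where "bilinear_on V b \<longleftrightarrow>
    (\<forall>y\<in>V. linear_on V (\<lambda>x. b x y)) \<and> (\<forall>x\<in>V. linear_on V (\<lambda>y. b x y))"

(* Signature (1,1): V has an orthonormal basis with one positive and one negative vector. *)
definition lorentz_form :: "'v::real_vector set \<Rightarrow> ('v \<Rightarrow> 'v \<Rightarrow> real) \<Rightarrow> bool"
  where "lorentz_form V b \<longleftrightarrow>
    bilinear_on V b \<and> (\<forall>x\<in>V. \<forall>y\<in>V. b x y = b y x) \<and>
    (\<exists>e1 e2. span {e1, e2} = V \<and> b e1 e1 = 1 \<and> b e2 e2 = -1 \<and> b e1 e2 = 0)"

(* Below, a bundle is described by its fibres F and its space G of smooth sections; for the
   tangent bundle these are tangent_space M and vector_fields M. *)
definition lorentz_metric ::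
  "'m chart set \<Rightarrow> ('m \<Rightarrow> 'v::real_vector set) \<Rightarrow> ('m \<Rightarrow> 'v) set \<Rightarrow> ('m \<Rightarrow> 'v \<Rightarrow> 'v \<Rightarrow> real) \<Rightarrow> bool"
  where "lorentz_metric M F G b \<longleftrightarrow>
    (\<forall>p. lorentz_form (F p) (b p)) \<and>
    (\<forall>s\<in>G. \<forall>t\<in>G. (\<lambda>p. b p (s p) (t p)) \<in> smooth_functions M)"

(* D p x s is the covariant derivative at p of the section s in the direction of the tangent
   vector x at p. *)
type_synonym ('m, 'v) conn = "'m \<Rightarrow> 'm tvec \<Rightarrow> ('m \<Rightarrow> 'v) \<Rightarrow> 'v"

definition connection ::
  "'m chart set \<Rightarrow> ('m \<Rightarrow> 'v::real_vector set) \<Rightarrow> ('m \<Rightarrow> 'v) set \<Rightarrow> ('m, 'v) conn \<Rightarrow> bool"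
  where "connection M F G D \<longleftrightarrow>
    (\<forall>p. \<forall>x\<in>tangent_space M p. \<forall>s\<in>G. D p x s \<in> F p) \<and>
    (\<forall>p. \<forall>s\<in>G. linear_on (tangent_space M p) (\<lambda>x. D p x s)) \<and>
    (\<forall>p. \<forall>x\<in>tangent_space M p. \<forall>s\<in>G. \<forall>t\<in>G. D p x (\<lambda>q. s q + t q) = D p x s + D p x t) \<and>
    (\<forall>p. \<forall>x\<in>tangent_space M p. \<forall>f\<in>smooth_functions M. \<forall>s\<in>G.
       D p x (\<lambda>q. f q *\<^sub>R s q) = x f *\<^sub>R s p + f p *\<^sub>R D p x s) \<and>
    (\<forall>X\<in>vector_fields M. \<forall>s\<in>G. (\<lambda>p. D p (X p) s) \<in> G)"

definition metric_compatible ::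
  "'m chart set \<Rightarrow> ('m \<Rightarrow> 'v) set \<Rightarrow> ('m \<Rightarrow> 'v \<Rightarrow> 'v \<Rightarrow> real) \<Rightarrow> ('m, 'v) conn \<Rightarrow> bool"
  where "metric_compatible M G b D \<longleftrightarrow>
    (\<forall>p. \<forall>x\<in>tangent_space M p. \<forall>s\<in>G. \<forall>t\<in>G.
       x (\<lambda>q. b q (s q) (t q)) = b p (D p x s) (t p) + b p (s p) (D p x t))"

definition curvature ::
  "('m, 'v::real_vector) conn \<Rightarrow> ('m \<Rightarrow> 'm tvec) \<Rightarrow> ('m \<Rightarrow> 'm tvec) \<Rightarrow> ('m \<Rightarrow> 'v) \<Rightarrow> 'm \<Rightarrow> 'v"
  where "curvature D X Y s p =
    D p (X p) (\<lambda>q. D q (Y q) s) - D p (Y p) (\<lambda>q. D q (X q) s) - D p (lie_bracket X Y p) s"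

definition levi_civita ::
  "'m chart set \<Rightarrow> ('m \<Rightarrow> 'm tvec \<Rightarrow> 'm tvec \<Rightarrow> real) \<Rightarrow> ('m, 'm tvec) conn \<Rightarrow> bool"
  where "levi_civita M g nab \<longleftrightarrow>
    connection M (tangent_space M) (vector_fields M) nab \<and>
    metric_compatible M (vector_fields M) g nab \<and>
    (\<forall>X\<in>vector_fields M. \<forall>Y\<in>vector_fields M. \<forall>p.
       nab p (X p) Y - nab p (Y p) X = lie_bracket X Y p)"

definition lorentz_surface ::
  "'m::{t2_space, second_countable_topology} chart set \<Rightarrow> ('m \<Rightarrow> 'm tvec \<Rightarrow> 'm tvec \<Rightarrow> real) \<Rightarrow> bool"
  where "lorentz_surface M g \<longleftrightarrow>
    smooth_surface M \<and> lorentz_metric M (tangent_space M) (vector_fields M) g"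


section \<open>Lorentzian Kaehler surface data\<close>

(* The bundle E, the direct sum of TM and N: elements are pairs (tangent part, normal part). *)
definition E_fibre ::
  "'m chart set \<Rightarrow> ('m \<Rightarrow> 'v::real_vector set) \<Rightarrow> 'm \<Rightarrow> ('m tvec \<times> 'v) set"
  where "E_fibre M N p = tangent_space M p \<times> N p"

definition E_sections ::
  "'m chart set \<Rightarrow> ('m \<Rightarrow> 'v::real_vector set) \<Rightarrow> ('m, 'v) trivialization set \<Rightarrow> ('m \<Rightarrow> 'm tvec \<times> 'v) set"
  where "E_sections M N T = {\<sigma>. (\<lambda>p. fst (\<sigma> p)) \<in> vector_fields M \<and>
                               (\<lambda>p. snd (\<sigma> p)) \<in> bundle_sections M N T}"

definition tang :: "'m tvec \<Rightarrow> 'm tvec \<times> 'v::real_vector"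
  where "tang x = (x, 0)"

definition nor :: "'v::real_vector \<Rightarrow> 'm tvec \<times> 'v"
  where "nor \<xi> = (0, \<xi>)"

definition E_metric ::
  "('m \<Rightarrow> 'm tvec \<Rightarrow> 'm tvec \<Rightarrow> real) \<Rightarrow> ('m \<Rightarrow> 'v::real_vector \<Rightarrow> 'v \<Rightarrow> real) \<Rightarrow>
   'm \<Rightarrow> 'm tvec \<times> 'v \<Rightarrow> 'm tvec \<times> 'v \<Rightarrow> real"
  where "E_metric g gN p \<sigma> \<tau> = g p (fst \<sigma>) (fst \<tau>) + gN p (snd \<sigma>) (snd \<tau>)"

definition second_fundamental_form ::
  "'m chart set \<Rightarrow> ('m \<Rightarrow> 'v::real_vector set) \<Rightarrow> ('m, 'v) trivialization set \<Rightarrow>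
   ('m \<Rightarrow> 'm tvec \<Rightarrow> 'm tvec \<Rightarrow> 'v) \<Rightarrow> bool"
  where "second_fundamental_form M N T h \<longleftrightarrow>
    (\<forall>p. bilinear_on (tangent_space M p) (h p) \<and>
       (\<forall>x\<in>tangent_space M p. \<forall>y\<in>tangent_space M p. h p x y \<in> N p \<and> h p x y = h p y x)) \<and>
    (\<forall>X\<in>vector_fields M. \<forall>Y\<in>vector_fields M. (\<lambda>p. h p (X p) (Y p)) \<in> bundle_sections M N T)"

(* shape_operator M g gN h p \<xi> x is the vector A_\<xi> x in the tangent space at p; it is well defined
   because g is nondegenerate. *)
definition shape_operator ::
  "'m chart set \<Rightarrow> ('m \<Rightarrow> 'm tvec \<Rightarrow> 'm tvec \<Rightarrow> real) \<Rightarrow> ('m \<Rightarrow> 'v::real_vector \<Rightarrow> 'v \<Rightarrow> real) \<Rightarrow>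
   ('m \<Rightarrow> 'm tvec \<Rightarrow> 'm tvec \<Rightarrow> 'v) \<Rightarrow> 'm \<Rightarrow> 'v \<Rightarrow> 'm tvec \<Rightarrow> 'm tvec"
  where "shape_operator M g gN h p \<xi> x = (THE v. v \<in> tangent_space M p \<and>
    (\<forall>y\<in>tangent_space M p. g p v y = E_metric g gN p (nor (h p x y)) (nor \<xi>)))"

(* The formulas of Gauss and Weingarten, applied to the tangent and normal part of \<sigma>. *)
definition E_connection ::
  "'m chart set \<Rightarrow> ('m \<Rightarrow> 'm tvec \<Rightarrow> 'm tvec \<Rightarrow> real) \<Rightarrow> ('m, 'm tvec) conn \<Rightarrow>
   ('m \<Rightarrow> 'v::real_vector \<Rightarrow> 'v \<Rightarrow> real) \<Rightarrow> ('m, 'v) conn \<Rightarrow> ('m \<Rightarrow> 'm tvec \<Rightarrow> 'm tvec \<Rightarrow> 'v) \<Rightarrow>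
   ('m, 'm tvec \<times> 'v) conn"
  where "E_connection M g nab gN D h p x \<sigma> =
    (tang (nab p x (\<lambda>q. fst (\<sigma> q))) + nor (h p x (fst (\<sigma> p)))) +
    (- tang (shape_operator M g gN h p (snd (\<sigma> p)) x) + nor (D p x (\<lambda>q. snd (\<sigma> q))))"

definition parallel_complex_structure ::
  "'m chart set \<Rightarrow> ('m \<Rightarrow> 'm tvec \<Rightarrow> 'm tvec \<Rightarrow> real) \<Rightarrow> ('m, 'm tvec) conn \<Rightarrow>
   ('m \<Rightarrow> 'v::real_vector set) \<Rightarrow> ('m, 'v) trivialization set \<Rightarrow> ('m \<Rightarrow> 'v \<Rightarrow> 'v \<Rightarrow> real) \<Rightarrow>
   ('m, 'v) conn \<Rightarrow> ('m \<Rightarrow> 'm tvec \<Rightarrow> 'm tvec \<Rightarrow> 'v) \<Rightarrow>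
   ('m \<Rightarrow> 'm tvec \<times> 'v \<Rightarrow> 'm tvec \<times> 'v) \<Rightarrow> bool"
  where "parallel_complex_structure M g nab N T gN D h J \<longleftrightarrow>
    (\<forall>p. linear_on (E_fibre M N p) (J p) \<and>
       (\<forall>\<sigma>\<in>E_fibre M N p. J p \<sigma> \<in> E_fibre M N p \<and> J p (J p \<sigma>) = - \<sigma>) \<and>
       (\<forall>\<sigma>\<in>E_fibre M N p. \<forall>\<tau>\<in>E_fibre M N p.
          E_metric g gN p (J p \<sigma>) (J p \<tau>) = E_metric g gN p \<sigma> \<tau>)) \<and>
    (\<forall>\<sigma>\<in>E_sections M N T. (\<lambda>p. J p (\<sigma> p)) \<in> E_sections M N T) \<and>
    (\<forall>p. \<forall>x\<in>tangent_space M p. \<forall>\<sigma>\<in>E_sections M N T.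
       E_connection M g nab gN D h p x (\<lambda>q. J q (\<sigma> q)) = J p (E_connection M g nab gN D h p x \<sigma>))"

definition kaehler_curvature_tensor ::
  "'m chart set \<Rightarrow> ('m \<Rightarrow> 'v::real_vector set) \<Rightarrow> ('m, 'v) trivialization set \<Rightarrow>
   ('m \<Rightarrow> 'm tvec \<times> 'v \<Rightarrow> 'm tvec \<times> 'v) \<Rightarrow>
   ('m \<Rightarrow> 'm tvec \<times> 'v \<Rightarrow> 'm tvec \<times> 'v \<Rightarrow> 'm tvec \<times> 'v \<Rightarrow> 'm tvec \<times> 'v \<Rightarrow> real) \<Rightarrow> bool"
  where "kaehler_curvature_tensor M N T J R \<longleftrightarrow>
    (\<forall>p. \<forall>x\<in>E_fibre M N p. \<forall>y\<in>E_fibre M N p. \<forall>z\<in>E_fibre M N p.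
       linear_on (E_fibre M N p) (\<lambda>w. R p w x y z) \<and>
       linear_on (E_fibre M N p) (\<lambda>w. R p x w y z) \<and>
       linear_on (E_fibre M N p) (\<lambda>w. R p x y w z) \<and>
       linear_on (E_fibre M N p) (\<lambda>w. R p x y z w)) \<and>
    (\<forall>X\<in>E_sections M N T. \<forall>Y\<in>E_sections M N T. \<forall>Z\<in>E_sections M N T. \<forall>W\<in>E_sections M N T.
       (\<lambda>p. R p (X p) (Y p) (Z p) (W p)) \<in> smooth_functions M) \<and>
    (\<forall>p. \<forall>x\<in>E_fibre M N p. \<forall>y\<in>E_fibre M N p. \<forall>z\<in>E_fibre M N p. \<forall>w\<in>E_fibre M N p.
       R p x y z w = - R p y x z w \<and>
       R p x y z w = R p z w x y \<and>
       R p x y (J p z) w = - R p x y z (J p w))"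

definition lorentzian_kaehler_surface_data ::
  "'m chart set \<Rightarrow> ('m \<Rightarrow> 'm tvec \<Rightarrow> 'm tvec \<Rightarrow> real) \<Rightarrow> ('m, 'm tvec) conn \<Rightarrow>
   ('m::topological_space \<Rightarrow> 'v::real_vector set) \<Rightarrow> ('m, 'v) trivialization set \<Rightarrow>
   ('m \<Rightarrow> 'v \<Rightarrow> 'v \<Rightarrow> real) \<Rightarrow> ('m, 'v) conn \<Rightarrow> ('m \<Rightarrow> 'm tvec \<Rightarrow> 'm tvec \<Rightarrow> 'v) \<Rightarrow>
   ('m \<Rightarrow> 'm tvec \<times> 'v \<Rightarrow> 'm tvec \<times> 'v) \<Rightarrow>
   ('m \<Rightarrow> 'm tvec \<times> 'v \<Rightarrow> 'm tvec \<times> 'v \<Rightarrow> 'm tvec \<times> 'v \<Rightarrow> 'm tvec \<times> 'v \<Rightarrow> real) \<Rightarrow> bool"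
  where "lorentzian_kaehler_surface_data M g nab N T gN D h J Rt \<longleftrightarrow>
    rank2_bundle M N T \<and>
    lorentz_metric M N (bundle_sections M N T) gN \<and>
    connection M N (bundle_sections M N T) D \<and>
    metric_compatible M (bundle_sections M N T) gN D \<and>
    second_fundamental_form M N T h \<and>
    parallel_complex_structure M g nab N T gN D h J \<and>
    kaehler_curvature_tensor M N T J Rt"

(* The vector Rt(x,y)z of the fibre of E obtained from the 4-linear form by raising an index. *)
definition curvature_vector ::
  "'m chart set \<Rightarrow> ('m \<Rightarrow> 'm tvec \<Rightarrow> 'm tvec \<Rightarrow> real) \<Rightarrow> ('m \<Rightarrow> 'v::real_vector set) \<Rightarrow>
   ('m \<Rightarrow> 'v \<Rightarrow> 'v \<Rightarrow> real) \<Rightarrow>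
   ('m \<Rightarrow> 'm tvec \<times> 'v \<Rightarrow> 'm tvec \<times> 'v \<Rightarrow> 'm tvec \<times> 'v \<Rightarrow> 'm tvec \<times> 'v \<Rightarrow> real) \<Rightarrow>
   'm \<Rightarrow> 'm tvec \<times> 'v \<Rightarrow> 'm tvec \<times> 'v \<Rightarrow> 'm tvec \<times> 'v \<Rightarrow> 'm tvec \<times> 'v"
  where "curvature_vector M g N gN Rt p x y z = (THE v. v \<in> E_fibre M N p \<and>
    (\<forall>w\<in>E_fibre M N p. E_metric g gN p v w = Rt p x y z w))"

(* cov_deriv_h nab D h X Y Z is the covariant derivative of h in direction X, applied to (Y, Z). *)
definition cov_deriv_h ::
  "('m, 'm tvec) conn \<Rightarrow> ('m, 'v::real_vector) conn \<Rightarrow> ('m \<Rightarrow> 'm tvec \<Rightarrow> 'm tvec \<Rightarrow> 'v) \<Rightarrow>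
   ('m \<Rightarrow> 'm tvec) \<Rightarrow> ('m \<Rightarrow> 'm tvec) \<Rightarrow> ('m \<Rightarrow> 'm tvec) \<Rightarrow> 'm \<Rightarrow> 'v"
  where "cov_deriv_h nab D h X Y Z p =
    D p (X p) (\<lambda>q. h q (Y q) (Z q)) - h p (nab p (X p) Y) (Z p) - h p (Y p) (nab p (X p) Z)"

(* The three fundamental equations are tensorial; they are evaluated at every point on smooth
   vector fields and smooth sections, through which every vector of the fibre passes. *)
definition gauss_equation ::
  "'m chart set \<Rightarrow> ('m \<Rightarrow> 'm tvec \<Rightarrow> 'm tvec \<Rightarrow> real) \<Rightarrow> ('m, 'm tvec) conn \<Rightarrow>
   ('m \<Rightarrow> 'v::real_vector \<Rightarrow> 'v \<Rightarrow> real) \<Rightarrow> ('m \<Rightarrow> 'm tvec \<Rightarrow> 'm tvec \<Rightarrow> 'v) \<Rightarrow>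
   ('m \<Rightarrow> 'm tvec \<times> 'v \<Rightarrow> 'm tvec \<times> 'v \<Rightarrow> 'm tvec \<times> 'v \<Rightarrow> 'm tvec \<times> 'v \<Rightarrow> real) \<Rightarrow> bool"
  where "gauss_equation M g nab gN h Rt \<longleftrightarrow>
    (\<forall>p. \<forall>X\<in>vector_fields M. \<forall>Y\<in>vector_fields M. \<forall>Z\<in>vector_fields M. \<forall>W\<in>vector_fields M.
       g p (curvature nab X Y Z p) (W p) =
         Rt p (tang (X p)) (tang (Y p)) (tang (Z p)) (tang (W p))
         + E_metric g gN p (nor (h p (X p) (W p))) (nor (h p (Y p) (Z p)))
         - E_metric g gN p (nor (h p (X p) (Z p))) (nor (h p (Y p) (W p))))"

definition codazzi_equation ::
  "'m chart set \<Rightarrow> ('m \<Rightarrow> 'm tvec \<Rightarrow> 'm tvec \<Rightarrow> real) \<Rightarrow> ('m, 'm tvec) conn \<Rightarrow>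
   ('m \<Rightarrow> 'v::real_vector set) \<Rightarrow> ('m \<Rightarrow> 'v \<Rightarrow> 'v \<Rightarrow> real) \<Rightarrow> ('m, 'v) conn \<Rightarrow>
   ('m \<Rightarrow> 'm tvec \<Rightarrow> 'm tvec \<Rightarrow> 'v) \<Rightarrow>
   ('m \<Rightarrow> 'm tvec \<times> 'v \<Rightarrow> 'm tvec \<times> 'v \<Rightarrow> 'm tvec \<times> 'v \<Rightarrow> 'm tvec \<times> 'v \<Rightarrow> real) \<Rightarrow> bool"
  where "codazzi_equation M g nab N gN D h Rt \<longleftrightarrow>
    (\<forall>p. \<forall>X\<in>vector_fields M. \<forall>Y\<in>vector_fields M. \<forall>Z\<in>vector_fields M.
       snd (curvature_vector M g N gN Rt p (tang (X p)) (tang (Y p)) (tang (Z p))) =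
         cov_deriv_h nab D h X Y Z p - cov_deriv_h nab D h Y X Z p)"

definition ricci_equation ::
  "'m chart set \<Rightarrow> ('m \<Rightarrow> 'm tvec \<Rightarrow> 'm tvec \<Rightarrow> real) \<Rightarrow>
   ('m \<Rightarrow> 'v::real_vector set) \<Rightarrow> ('m, 'v) trivialization set \<Rightarrow> ('m \<Rightarrow> 'v \<Rightarrow> 'v \<Rightarrow> real) \<Rightarrow>
   ('m, 'v) conn \<Rightarrow> ('m \<Rightarrow> 'm tvec \<Rightarrow> 'm tvec \<Rightarrow> 'v) \<Rightarrow>
   ('m \<Rightarrow> 'm tvec \<times> 'v \<Rightarrow> 'm tvec \<times> 'v \<Rightarrow> 'm tvec \<times> 'v \<Rightarrow> 'm tvec \<times> 'v \<Rightarrow> real) \<Rightarrow> bool"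
  where "ricci_equation M g N T gN D h Rt \<longleftrightarrow>
    (\<forall>p. \<forall>X\<in>vector_fields M. \<forall>Y\<in>vector_fields M.
       \<forall>\<xi>\<in>bundle_sections M N T. \<forall>\<eta>\<in>bundle_sections M N T.
       E_metric g gN p (nor (curvature D X Y \<xi> p)) (nor (\<eta> p)) =
         Rt p (tang (X p)) (tang (Y p)) (nor (\<xi> p)) (nor (\<eta> p))
         + (let A = shape_operator M g gN h p in
            g p (A (\<xi> p) (A (\<eta> p) (X p)) - A (\<eta> p) (A (\<xi> p) (X p))) (Y p)))"

end

(* Let K be the curvature of the connection on E = TM + N, and S = K(X,Y) - Rt(X,Y), a skew form
   on E for which J is skew. The equations of Gauss and Codazzi say that S(Z, .) = 0 for tangent Z,
   and then S(JZ, .) = -S(Z, J.) = 0 as well. A J-invariant tangent plane would carry an orthogonal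
   complex structure, which is impossible in signature (1,1), so at every point some JZ has a
   nonzero normal part F. Then S(F, .) = 0 on the plane N, and a skew form on a plane with a nonzero
   null vector vanishes; that is the equation of Ricci. *)

theory Submission
  imports Defs
begin

text \<open>J is skew for S because J is parallel, so that K(X,Y) commutes with J, and because the
  same relation is postulated for \<open>Rt\<close>. S is never formed as a whole: K is computed
  only on sections \<open>(Z, 0)\<close>, and its image under J is read as K applied to
  \<open>(P, F)\<close>, the tangent and normal parts of JZ. The equation of Codazzi for P removes
  the tangent part and leaves the Ricci defect of F. The obstacle is the passage from points to
  sections. The equations are quantified over global vector fields, so every tangent vector at p has
  to be the value of one. This is what the C^k calculus and the bump functions are for. On the
  normal side a section is at hand: F is the normal part of JZ. Tangent spaces consist of
  derivations; that they are at most 2-dimensional is read off from the metric, whose orthonormal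
  basis spans them, so two independent fields near p reach every tangent vector.\<close>

section \<open>Functions of class C^k\<close>

lemma Ck_on_cong:
  assumes "open S" "\<And>x. x \<in> S \<Longrightarrow> f x = g x" "Ck_on k S f"
  shows "Ck_on k S g"
  using assms(2,3)
proof (induction k arbitrary: f g)
  case 0
  then show ?case by (metis Ck_on.simps(1) continuous_on_cong)
next
  case (Suc k)
  have deriv: "(g has_derivative frechet_derivative f (at x)) (at x)" if "x \<in> S" for x
  proof (rule has_derivative_transform_within_open[OF _ \<open>open S\<close> that])
    show "(f has_derivative frechet_derivative f (at x)) (at x)"
      using Suc.prems(2) that by (auto simp: frechet_derivative_works)
  qed (simp add: Suc.prems(1))
  have "Ck_on k S (\<lambda>x. frechet_derivative g (at x) v)" for v
    by (rule Suc.IH[of "\<lambda>x. frechet_derivative f (at x) v"])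
      (use Suc.prems(2) frechet_derivative_at[OF deriv] in \<open>simp_all\<close>)
  then show ?case
    using deriv by (auto simp: differentiable_def)
qed

lemma Ck_on_Suc_derivI:
  assumes "open S" "\<And>x. x \<in> S \<Longrightarrow> (f has_derivative f' x) (at x)"
    and "\<And>v. Ck_on k S (\<lambda>x. f' x v)"
  shows "Ck_on (Suc k) S f"
proof -
  have "frechet_derivative f (at x) = f' x" if "x \<in> S" for x
    using assms(2)[OF that] by (metis frechet_derivative_at)
  then have "Ck_on k S (\<lambda>x. frechet_derivative f (at x) v)" for v
    by (intro Ck_on_cong[OF \<open>open S\<close> _ assms(3)[of v]]) simp
  then show ?thesis
    using assms(2) by (auto simp: differentiable_def)
qed

lemma Ck_on_SucD:
  assumes "Ck_on (Suc k) S f"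
  shows "x \<in> S \<Longrightarrow> (f has_derivative frechet_derivative f (at x)) (at x)"
    and "Ck_on k S (\<lambda>x. frechet_derivative f (at x) v)"
  using assms by (auto simp: frechet_derivative_works)

lemma Ck_on_Suc_imp: "Ck_on (Suc k) S f \<Longrightarrow> Ck_on k S f"
proof (induction k arbitrary: f)
  case 0
  then show ?case
    by (auto intro: continuous_at_imp_continuous_on differentiable_imp_continuous_within)
qed auto

lemma Ck_on_subset: "Ck_on k S f \<Longrightarrow> A \<subseteq> S \<Longrightarrow> Ck_on k A f"
  by (induction k arbitrary: f) (auto intro: continuous_on_subset)

text \<open>Derivatives are taken \<open>at x\<close> in the whole space, whatever the set, so only
  continuity at the bottom of the recursion has to be glued.\<close>

lemma Ck_on_Un:
  "open A \<Longrightarrow> open B \<Longrightarrow> Ck_on k A f \<Longrightarrow> Ck_on k B f \<Longrightarrow> Ck_on k (A \<union> B) f"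
  by (induction k arbitrary: f) (auto intro: continuous_on_open_Un)

lemma Ck_on_const: "Ck_on k S (\<lambda>x. c)"
  by (induction k arbitrary: c) auto

lemma Ck_on_bounded_linear:
  assumes "bounded_linear L" "open S" "Ck_on k S f"
  shows "Ck_on k S (\<lambda>x. L (f x))"
  using assms(3)
proof (induction k arbitrary: f)
  case 0
  then show ?case
    using bounded_linear.continuous_on[OF assms(1)] by auto
next
  case (Suc k)
  note D = Ck_on_SucD[OF Suc.prems]
  show ?case
    by (rule Ck_on_Suc_derivI[OF \<open>open S\<close> bounded_linear.has_derivative[OF assms(1) D(1)]
          Suc.IH[OF D(2)]])
qed

lemma Ck_on_add:
  assumes "open S" "Ck_on k S f" "Ck_on k S g"
  shows "Ck_on k S (\<lambda>x. f x + g x)"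
  using assms(2,3)
proof (induction k arbitrary: f g)
  case 0
  then show ?case by (auto intro: continuous_on_add)
next
  case (Suc k)
  note D = Ck_on_SucD[OF Suc.prems(1)] Ck_on_SucD[OF Suc.prems(2)]
  show ?case
    by (rule Ck_on_Suc_derivI[OF \<open>open S\<close> has_derivative_add[OF D(1,3)] Suc.IH[OF D(2,4)]])
qed

lemma Ck_on_sum:
  assumes "open S" "\<And>i. i \<in> I \<Longrightarrow> Ck_on k S (f i)"
  shows "Ck_on k S (\<lambda>x. \<Sum>i\<in>I. f i x)"
  using assms(2)
  by (induction I rule: infinite_finite_induct) (auto intro: Ck_on_const Ck_on_add[OF assms(1)])

lemma Ck_on_bilinear:
  assumes "bounded_bilinear b" "open S" "Ck_on k S f" "Ck_on k S g"
  shows "Ck_on k S (\<lambda>x. b (f x) (g x))"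
  using assms(3,4)
proof (induction k arbitrary: f g)
  case 0
  then show ?case by (auto intro: bounded_bilinear.continuous_on[OF assms(1)])
next
  case (Suc k)
  note D = Ck_on_SucD[OF Suc.prems(1)] Ck_on_SucD[OF Suc.prems(2)]
  have "Ck_on k S (\<lambda>x. b (f x) (frechet_derivative g (at x) v)
      + b (frechet_derivative f (at x) v) (g x))" for v
    by (intro Ck_on_add[OF \<open>open S\<close>] Suc.IH D Ck_on_Suc_imp[OF Suc.prems(1)]
        Ck_on_Suc_imp[OF Suc.prems(2)])
  then show ?case
    by (rule Ck_on_Suc_derivI[where f' = "\<lambda>x v. b (f x) (frechet_derivative g (at x) v)
        + b (frechet_derivative f (at x) v) (g x)", rotated 2])
      (auto intro: bounded_bilinear.FDERIV[OF assms(1) D(1,3)] \<open>open S\<close>)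
qed

lemmas Ck_on_mult = Ck_on_bilinear[OF bounded_bilinear_mult]
  and Ck_on_scaleR = Ck_on_bilinear[OF bounded_bilinear_scaleR]

lemma Ck_on_compose:
  fixes f :: "'a::euclidean_space \<Rightarrow> 'b::euclidean_space" and g :: "'b \<Rightarrow> 'c::real_normed_vector"
  assumes "open S" "f ` S \<subseteq> A" "Ck_on k S f" "Ck_on k A g"
  shows "Ck_on k S (\<lambda>x. g (f x))"
  using assms(3,4)
proof (induction k arbitrary: g)
  case 0
  then show ?case using assms(2) by (auto intro: continuous_on_compose2)
next
  case (Suc k)
  note D = Ck_on_SucD[OF Suc.prems(1)] Ck_on_SucD[OF Suc.prems(2)]
  let ?f' = "\<lambda>x. frechet_derivative f (at x)" and ?g' = "\<lambda>y. frechet_derivative g (at y)"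
  \<comment> \<open>In the chain rule the direction in which g is differentiated varies with x,
    whereas \<open>Ck_on\<close> speaks of fixed directions. Expanding that direction in
    \<open>Basis\<close> leaves fixed directions with C^k coefficients.\<close>
  have "Ck_on k S (\<lambda>x. \<Sum>b\<in>Basis. (?f' x v \<bullet> b) *\<^sub>R ?g' (f x) b)" for v
    by (intro Ck_on_sum[OF \<open>open S\<close>] Ck_on_scaleR[OF \<open>open S\<close>]
        Ck_on_bounded_linear[OF bounded_linear_inner_left \<open>open S\<close>] D Suc.IH
        Ck_on_Suc_imp[OF Suc.prems(1)])
  then show ?case
  proof (rule Ck_on_Suc_derivI[where f' = "\<lambda>x v. \<Sum>b\<in>Basis. (?f' x v \<bullet> b) *\<^sub>R ?g' (f x) b",
          rotated 2])
    fix x assume x: "x \<in> S"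
    then have g': "(g has_derivative ?g' (f x)) (at (f x))"
      using D(3) assms(2) by blast
    then interpret G: bounded_linear "?g' (f x)"
      by (rule has_derivative_bounded_linear)
    have "?g' (f x) w = (\<Sum>b\<in>Basis. (w \<bullet> b) *\<^sub>R ?g' (f x) b)" for w
      by (subst euclidean_representation[of w, symmetric]) (simp only: G.sum G.scaleR)
    then have "?g' (f x) (?f' x w) = (\<Sum>b\<in>Basis. (?f' x w \<bullet> b) *\<^sub>R ?g' (f x) b)" for w
      by blast
    then show "((\<lambda>x. g (f x)) has_derivative
        (\<lambda>v. \<Sum>b\<in>Basis. (?f' x v \<bullet> b) *\<^sub>R ?g' (f x) b)) (at x)"
      using has_derivative_compose[OF D(1)[OF x] g'] by simp
  qed (fact \<open>open S\<close>)
qed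

lemma Ck_on_id: "open S \<Longrightarrow> Ck_on k S (\<lambda>x. x)"
proof (cases k)
  case (Suc m)
  then show "open S \<Longrightarrow> ?thesis"
    using Ck_on_Suc_derivI[of S "\<lambda>x. x" "\<lambda>x v. v" m] Ck_on_const by auto
qed auto


section \<open>Smooth bump functions\<close>

text \<open>The classical flat function exp(-1/t), with a polynomial factor in 1/t so that the
  family is closed under differentiation and smoothness follows by induction over all p at
  once.\<close>

definition flat_exp :: "real poly \<Rightarrow> real \<Rightarrow> real"
  where "flat_exp p t = (if t > 0 then poly p (inverse t) * exp (- inverse t) else 0)"

lemma poly_times_exp_minus_tendsto_0: "((\<lambda>y. poly p y * exp (- y)) \<longlongrightarrow> (0::real)) at_top"
proof -
  have "((\<lambda>y. \<Sum>i\<le>degree p. coeff p i * (y ^ i / exp y)) \<longlongrightarrow> (\<Sum>i\<le>degree p. coeff p i * 0)) at_top"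
    by (intro tendsto_intros tendsto_power_div_exp_0)
  then show ?thesis
    by (simp add: poly_altdef sum_distrib_right exp_minus divide_inverse mult.assoc)
qed

lemma flat_exp_tendsto_0: "(flat_exp p \<longlongrightarrow> 0) (at 0)"
proof -
  have "((\<lambda>t. poly p (inverse t) * exp (- inverse t)) \<longlongrightarrow> 0) (at_right (0::real))"
    by (rule filterlim_compose[OF poly_times_exp_minus_tendsto_0 filterlim_inverse_at_top_right])
  then have "(flat_exp p \<longlongrightarrow> 0) (at_right 0)"
    by (rule Lim_transform_eventually) (auto simp: flat_exp_def eventually_at_right_less
        intro!: eventually_at_rightI[of 0 1])
  moreover have "(flat_exp p \<longlongrightarrow> 0) (at_left 0)"
    by (rule Lim_transform_eventually[OF tendsto_const])
      (auto simp: flat_exp_def intro!: eventually_at_leftI[of "-1" 0])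
  ultimately show ?thesis
    by (simp add: filterlim_split_at)
qed

text \<open>For t > 0 the derivative of p(1/t) exp(-1/t) is (1/t^2) (p(1/t) - p'(1/t)) exp(-1/t),
  which explains the new polynomial.\<close>

lemma flat_exp_has_derivative:
  "(flat_exp p has_real_derivative flat_exp ([:0, 0, 1:] * (p - pderiv p)) t) (at t)"
proof -
  consider "t > 0" | "t < 0" | "t = 0" by linarith
  then show ?thesis
  proof cases
    case 1
    have "((\<lambda>t. poly p (inverse t) * exp (- inverse t)) has_real_derivative
        flat_exp ([:0, 0, 1:] * (p - pderiv p)) t) (at t)"
      using 1 by (auto simp: flat_exp_def field_simps power2_eq_square
          intro!: derivative_eq_intros DERIV_chain'[OF _ poly_DERIV])
    then show ?thesis
      by (rule has_field_derivative_transform_within_open[of _ _ _ "{0<..}"])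
        (use 1 in \<open>auto simp: flat_exp_def\<close>)
  next
    case 2
    have "((\<lambda>t. 0) has_real_derivative flat_exp ([:0, 0, 1:] * (p - pderiv p)) t) (at t)"
      using 2 by (simp add: flat_exp_def)
    then show ?thesis
      by (rule has_field_derivative_transform_within_open[of _ _ _ "{..<0}"])
        (use 2 in \<open>auto simp: flat_exp_def\<close>)
  next
    case 3
    \<comment> \<open>The difference quotient at 0 belongs to the same family, with p multiplied by
      the variable, so it tends to 0. At y = 0 both sides are 0, since division by zero gives
      0.\<close>
    have "flat_exp ([:0, 1:] * p) = (\<lambda>y. (flat_exp p y - flat_exp p 0) / (y - 0))"
      by (auto simp: flat_exp_def field_simps)
    then show ?thesis
      using flat_exp_tendsto_0[of "[:0, 1:] * p"] 3
      by (simp only: has_field_derivative_iff) (simp add: flat_exp_def)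
  qed
qed

lemma Ck_on_flat_exp: "Ck_on k UNIV (flat_exp p)"
proof (induction k arbitrary: p)
  case 0
  show ?case
    using flat_exp_has_derivative by (auto intro!: DERIV_continuous_on)
next
  case (Suc k)
  let ?q = "[:0, 0, 1:] * (p - pderiv p)"
  show ?case
    by (rule Ck_on_Suc_derivI[where f' = "\<lambda>x v. flat_exp ?q x * v"])
      (use flat_exp_has_derivative[of p, unfolded has_field_derivative_def] in
        \<open>auto intro!: Ck_on_mult Ck_on_const Suc\<close>)
qed

definition bump :: "'a::euclidean_space \<Rightarrow> real \<Rightarrow> 'a \<Rightarrow> real"
  where "bump a r x = flat_exp 1 (r\<^sup>2 - (x - a) \<bullet> (x - a))"

lemma Ck_on_bump: "Ck_on k UNIV (bump a r)"
proof -
  have diff: "Ck_on k UNIV (\<lambda>x. x - a)"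
    using Ck_on_add[OF open_UNIV Ck_on_id[OF open_UNIV] Ck_on_const[of k UNIV "- a"]] by simp
  have "Ck_on k UNIV (\<lambda>x. - ((x - a) \<bullet> (x - a)))"
    by (rule Ck_on_bounded_linear[OF bounded_linear_minus[OF bounded_linear_ident] open_UNIV
          Ck_on_bilinear[OF bounded_bilinear_inner open_UNIV diff diff]])
  from Ck_on_add[OF open_UNIV Ck_on_const[of k UNIV "r\<^sup>2"] this]
  have "Ck_on k UNIV (\<lambda>x. r\<^sup>2 - (x - a) \<bullet> (x - a))" by simp
  from Ck_on_compose[OF open_UNIV _ this Ck_on_flat_exp[of k 1]] show ?thesis
    by (simp add: bump_def[abs_def])
qed

lemma bump_center: "r > 0 \<Longrightarrow> bump a r a > 0"
  by (simp add: bump_def flat_exp_def)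

lemma bump_outside:
  assumes "r > 0" "x \<notin> ball a r"
  shows "bump a r x = 0"
proof -
  have "r\<^sup>2 \<le> (norm (x - a))\<^sup>2"
    using assms by (intro power_mono) (auto simp: dist_norm norm_minus_commute)
  then show ?thesis
    by (simp add: bump_def flat_exp_def power2_norm_eq_inner)
qed


section \<open>Lorentz planes\<close>

lemma span_pair: "x \<in> span {a, b} \<longleftrightarrow> (\<exists>s t. x = s *\<^sub>R a + t *\<^sub>R b)"
  by (auto simp: span_breakdown_eq algebra_simps)

text \<open>Cramer's rule, with d the determinant of a, b in terms of e1, e2. If d were 0, the two
  combinations in \<open>1\<close> and \<open>2\<close> would vanish, independence would kill all
  their coefficients, and a would be 0.\<close>

lemma span_pair_exchange:
  fixes a b e1 e2 v :: "'a::real_vector"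
  assumes "a \<in> span {e1, e2}" "b \<in> span {e1, e2}" "v \<in> span {e1, e2}"
    and indep: "\<And>s t. s *\<^sub>R a + t *\<^sub>R b = 0 \<Longrightarrow> s = 0 \<and> t = 0"
  obtains s t where "v = s *\<^sub>R a + t *\<^sub>R b"
proof -
  from assms(1-3) obtain a1 a2 b1 b2 v1 v2
    where a: "a = a1 *\<^sub>R e1 + a2 *\<^sub>R e2" and b: "b = b1 *\<^sub>R e1 + b2 *\<^sub>R e2"
      and v: "v = v1 *\<^sub>R e1 + v2 *\<^sub>R e2"
    unfolding span_pair by blast
  define d where "d = a1 * b2 - a2 * b1"
  have 1: "b2 *\<^sub>R a - a2 *\<^sub>R b = d *\<^sub>R e1" and 2: "a1 *\<^sub>R b - b1 *\<^sub>R a = d *\<^sub>R e2"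
    by (simp_all add: a b d_def algebra_simps)
  have "d \<noteq> 0"
  proof
    assume "d = 0"
    then have "a1 = 0" "a2 = 0"
      using 1 2 indep[of b2 "- a2"] indep[of "- b1" a1] by auto
    then show False using indep[of 1 0] a by simp
  qed
  then have "v = ((v1 / d) * b2 - (v2 / d) * b1) *\<^sub>R a + ((v2 / d) * a1 - (v1 / d) * a2) *\<^sub>R b"
  proof -
    have "v = (v1 / d) *\<^sub>R (d *\<^sub>R e1) + (v2 / d) *\<^sub>R (d *\<^sub>R e2)"
      using \<open>d \<noteq> 0\<close> v by simp
    then show ?thesis
      unfolding 1[symmetric] 2[symmetric] by (simp add: algebra_simps)
  qed
  then show thesis by (rule that)
qed

lemma linear_onD:
  assumes "linear_on V f"
  shows "x \<in> V \<Longrightarrow> y \<in> V \<Longrightarrow> f (x + y) = f x + f y"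
    and "x \<in> V \<Longrightarrow> f (c *\<^sub>R x) = c *\<^sub>R f x"
    and "x \<in> V \<Longrightarrow> f 0 = 0"
    and "x \<in> V \<Longrightarrow> f (- x) = - f x"
proof -
  show add: "x \<in> V \<Longrightarrow> y \<in> V \<Longrightarrow> f (x + y) = f x + f y"
    and scale: "x \<in> V \<Longrightarrow> f (c *\<^sub>R x) = c *\<^sub>R f x" for x y c
    using assms by (auto simp: linear_on_def)
  show "x \<in> V \<Longrightarrow> f 0 = 0" "x \<in> V \<Longrightarrow> f (- x) = - f x"
    using scale[of x 0] scale[of x "-1"] by auto
qed

lemma linear_on_diff:
  assumes "linear_on V f" "subspace V" "x \<in> V" "y \<in> V"
  shows "f (x - y) = f x - f y"
  using linear_onD(1)[OF assms(1,3), of "- y"] linear_onD(4)[OF assms(1,4)]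
    subspace_neg[OF assms(2,4)] by simp

text \<open>Meant for a single fibre: it is instantiated at every point for the tangent space and
  for the normal space. Linearity is relative to V because the maps are total functions with
  arbitrary values off V.\<close>

locale lorentz_plane =
  fixes V :: "'v::real_vector set" and b :: "'v \<Rightarrow> 'v \<Rightarrow> real"
  assumes form: "lorentz_form V b"
begin

lemma subsp: "subspace V"
  using form by (auto simp: lorentz_form_def intro: subspace_span)

lemmas zero_mem = subspace_0[OF subsp]

lemmas mem = zero_mem subspace_add[OF subsp] subspace_diff[OF subsp] subspace_scale[OF subsp]
  subspace_neg[OF subsp]

lemma sym: "x \<in> V \<Longrightarrow> y \<in> V \<Longrightarrow> b x y = b y x"
  using form by (auto simp: lorentz_form_def)

lemma lin: "y \<in> V \<Longrightarrow> linear_on V (\<lambda>x. b x y)" "x \<in> V \<Longrightarrow> linear_on V (b x)"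
  using form by (auto simp: lorentz_form_def bilinear_on_def)

lemma
  assumes "y \<in> V"
  shows add_left: "x \<in> V \<Longrightarrow> x' \<in> V \<Longrightarrow> b (x + x') y = b x y + b x' y"
    and diff_left: "x \<in> V \<Longrightarrow> x' \<in> V \<Longrightarrow> b (x - x') y = b x y - b x' y"
    and scale_left: "x \<in> V \<Longrightarrow> b (c *\<^sub>R x) y = c * b x y"
    and zero_left: "b 0 y = 0"
    and neg_left: "x \<in> V \<Longrightarrow> b (- x) y = - b x y"
  using linear_onD[OF lin(1)[OF assms]] linear_on_diff[OF lin(1)[OF assms] subsp] zero_mem
  by auto

lemma
  assumes "x \<in> V"
  shows add_right: "y \<in> V \<Longrightarrow> y' \<in> V \<Longrightarrow> b x (y + y') = b x y + b x y'"
    and diff_right: "y \<in> V \<Longrightarrow> y' \<in> V \<Longrightarrow> b x (y - y') = b x y - b x y'"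
    and scale_right: "y \<in> V \<Longrightarrow> b x (c *\<^sub>R y) = c * b x y"
    and zero_right: "b x 0 = 0"
    and neg_right: "y \<in> V \<Longrightarrow> b x (- y) = - b x y"
  using linear_onD[OF lin(2)[OF assms]] linear_on_diff[OF lin(2)[OF assms] subsp] zero_mem
  by auto

lemmas lefts = add_left diff_left scale_left zero_left neg_left
lemmas rights = add_right diff_right scale_right zero_right neg_right

lemma orthonormal_basis:
  obtains e1 e2 where "e1 \<in> V" "e2 \<in> V" "span {e1, e2} = V"
    "b e1 e1 = 1" "b e2 e2 = -1" "b e1 e2 = 0" "b e2 e1 = 0"
proof -
  from form obtain e1 e2 where e: "span {e1, e2} = V" "b e1 e1 = 1" "b e2 e2 = -1" "b e1 e2 = 0"
    by (auto simp: lorentz_form_def)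
  then have "e1 \<in> V" "e2 \<in> V"
    using span_superset[of "{e1, e2}"] by auto
  with e sym show thesis
    by (intro that[of e1 e2]) auto
qed

lemma nondegenerate:
  assumes "x \<in> V" and "\<And>y. y \<in> V \<Longrightarrow> b x y = 0"
  shows "x = 0"
proof -
  obtain e1 e2 where e: "e1 \<in> V" "e2 \<in> V" "span {e1, e2} = V"
    "b e1 e1 = 1" "b e2 e2 = -1" "b e1 e2 = 0" "b e2 e1 = 0"
    by (rule orthonormal_basis)
  obtain s t where x: "x = s *\<^sub>R e1 + t *\<^sub>R e2"
    using assms(1) span_pair[of x e1 e2] unfolding e(3) by blast
  have "b x e1 = s" "b x e2 = - t"
    using e by (simp_all add: x lefts mem)
  with assms(2)[of e1] assms(2)[of e2] e x show ?thesis by simp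
qed

text \<open>Needed to give meaning to the definite descriptions behind the shape operator and the
  ambient curvature vector.\<close>

lemma riesz:
  assumes f: "linear_on V f"
  shows "\<exists>!v. v \<in> V \<and> (\<forall>y\<in>V. b v y = f y)"
proof (rule ex_ex1I)
  obtain e1 e2 where e: "e1 \<in> V" "e2 \<in> V" "span {e1, e2} = V"
    "b e1 e1 = 1" "b e2 e2 = -1" "b e1 e2 = 0" "b e2 e1 = 0"
    by (rule orthonormal_basis)
  \<comment> \<open>The minus sign compensates \<open>b e2 e2 = -1\<close>.\<close>
  let ?v = "f e1 *\<^sub>R e1 - f e2 *\<^sub>R e2"
  have "b ?v y = f y" if y: "y \<in> V" for y
  proof -
    obtain s t where "y = s *\<^sub>R e1 + t *\<^sub>R e2"
      using y span_pair[of y e1 e2] unfolding e(3) by blast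
    then show ?thesis
      using e(1,2,4-) by (simp add: lefts rights mem linear_onD[OF f])
  qed
  with e(1,2) show "\<exists>v. v \<in> V \<and> (\<forall>y\<in>V. b v y = f y)"
    by (intro exI[of _ ?v]) (simp add: mem)
next
  fix v w
  assume "v \<in> V \<and> (\<forall>y\<in>V. b v y = f y)" "w \<in> V \<and> (\<forall>y\<in>V. b w y = f y)"
  then have "v - w = 0"
    by (intro nondegenerate) (auto simp: lefts mem)
  then show "v = w" by simp
qed

text \<open>The case split for a skew form with null vector x: either y is parallel to x, or v is a
  combination of x and y, and then skewness kills the y, y term.\<close>

lemma rank_2:
  assumes "x \<in> V" "y \<in> V" "v \<in> V" "x \<noteq> 0"
  obtains c where "y = c *\<^sub>R x" | s t where "v = s *\<^sub>R x + t *\<^sub>R y"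
proof (cases "\<exists>c. y = c *\<^sub>R x")
  case False
  obtain e1 e2 where e: "span {e1, e2} = V"
    by (rule orthonormal_basis)
  have "s = 0 \<and> t = 0" if "s *\<^sub>R x + t *\<^sub>R y = 0" for s t
  proof (cases "t = 0")
    case True
    then show ?thesis using that \<open>x \<noteq> 0\<close> by simp
  next
    case t: False
    have "t *\<^sub>R y = (- s) *\<^sub>R x"
      using that by (simp add: add_eq_0_iff)
    then have "inverse t *\<^sub>R t *\<^sub>R y = inverse t *\<^sub>R (- s) *\<^sub>R x" by simp
    then have "y = (inverse t * (- s)) *\<^sub>R x"
      using t by simp
    then show ?thesis using False by blast
  qed
  then show thesis
    using span_pair_exchange[of x e1 e2 y v] assms that(2) e by blast
qed (use that in blast)

lemma no_orthogonal_complex_structure: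
  assumes "\<And>x. x \<in> V \<Longrightarrow> j x \<in> V" "\<And>x. x \<in> V \<Longrightarrow> b (j x) (j x) = b x x"
    and "\<And>x. x \<in> V \<Longrightarrow> b (j x) x = 0"
  shows False
proof -
  obtain e1 e2 where e: "e1 \<in> V" "e2 \<in> V" "span {e1, e2} = V"
    "b e1 e1 = 1" "b e2 e2 = -1" "b e1 e2 = 0" "b e2 e1 = 0"
    by (rule orthonormal_basis)
  obtain s t where j: "j e1 = s *\<^sub>R e1 + t *\<^sub>R e2"
    using assms(1)[OF e(1)] span_pair[of "j e1" e1 e2] unfolding e(3) by blast
  have "s = 0"
    using assms(3)[OF e(1)] e by (simp add: j lefts mem)
  then have "- (t * t) = 1"
    using assms(2)[OF e(1)] e by (simp add: j lefts rights mem)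
  then show False
    using zero_le_square[of t] by linarith
qed

end


section \<open>Vector fields through given tangent vectors\<close>

lemma smooth_functions_iff:
  "f \<in> smooth_functions M \<longleftrightarrow> (\<forall>(U, \<phi>)\<in>M. \<forall>k. Ck_on k (\<phi> ` U) (\<lambda>x. f (inv_into U \<phi> x)))"
  by (simp add: smooth_functions_def smooth_map_on_def smooth_on_def comp_def)

text \<open>The coordinate derivative in the fixed direction w, multiplied by a cutoff function and
  continued by 0 outside the chart. The value 0 on non-smooth f is the convention of
  \<open>tangent_space\<close>.\<close>

definition cutoff_field ::
  "'m chart set \<Rightarrow> 'm chart \<Rightarrow> (real^2 \<Rightarrow> real) \<Rightarrow> real^2 \<Rightarrow> 'm \<Rightarrow> 'm tvec"
  where "cutoff_field M c \<beta> w q f = (case c of (U, \<phi>) \<Rightarrow>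
    (if q \<in> U \<and> f \<in> smooth_functions M
     then \<beta> (\<phi> q) * frechet_derivative (\<lambda>x. f (inv_into U \<phi> x)) (at (\<phi> q)) w else 0))"

context
  fixes M :: "'m::{t2_space, second_countable_topology} chart set"
  assumes surf: "smooth_surface M"
begin

lemma chart:
  assumes "(U, \<phi>) \<in> M"
  shows chart_open: "open U" and chart_open_range: "open (\<phi> ` U)"
    and chart_inv: "q \<in> U \<Longrightarrow> inv_into U \<phi> (\<phi> q) = q"
    and chart_cont_inv: "continuous_on (\<phi> ` U) (inv_into U \<phi>)"
  using surf assms by (auto simp: smooth_surface_def homeomorphism_def)

lemma chart_open_image:
  assumes "(U, \<phi>) \<in> M" "open W"
  shows "open (\<phi> ` (U \<inter> W))"
proof -
  have "\<phi> ` (U \<inter> W) = \<phi> ` U \<inter> inv_into U \<phi> -` W"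
    using chart_inv[OF assms(1)] by auto
  then show ?thesis
    using continuous_open_preimage[OF chart_cont_inv[OF assms(1)] chart_open_range[OF assms(1)]
        assms(2)] by simp
qed

lemma transition_Ck_on:
  assumes "(U, \<phi>) \<in> M" "(V, \<psi>) \<in> M"
  shows "Ck_on k (\<psi> ` (V \<inter> U)) (\<lambda>x. \<phi> (inv_into V \<psi> x))"
proof -
  have "smooth_map_on M U \<phi>"
    using surf assms(1) by (auto simp: smooth_surface_def)
  then show ?thesis
    using assms(2) by (auto simp: smooth_map_on_def smooth_on_def comp_def)
qed

lemma smooth_functions_mult:
  assumes "f \<in> smooth_functions M" "f' \<in> smooth_functions M"
  shows "(\<lambda>q. f q * f' q) \<in> smooth_functions M"
  unfolding smooth_functions_iff
  using assms[unfolded smooth_functions_iff] chart_open_range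
  by (fast intro: Ck_on_mult)

lemma smooth_functions_lincomb:
  assumes "f \<in> smooth_functions M" "f' \<in> smooth_functions M"
  shows "(\<lambda>q. a * f q + b * f' q) \<in> smooth_functions M"
  unfolding smooth_functions_iff
  using assms[unfolded smooth_functions_iff] chart_open_range
  by (fast intro: Ck_on_mult Ck_on_add Ck_on_const)

text \<open>The preimage K of the ball is compact, hence closed since the surface is Hausdorff. So U
  and the complement of K are open and cover the surface; on the first the function is u in a chart,
  on the second it is 0.\<close>

lemma smooth_functions_extend_by_zero:
  assumes U: "(U, \<phi>) \<in> M" and "cball a r \<subseteq> \<phi> ` U"
    and u: "\<And>k. Ck_on k (\<phi> ` U) u" and u0: "\<And>x. x \<notin> cball a r \<Longrightarrow> u x = 0"
  shows "(\<lambda>q. if q \<in> U then u (\<phi> q) else 0) \<in> smooth_functions M"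
  unfolding smooth_functions_iff
proof safe
  fix V \<psi> k
  assume V: "(V, \<psi>) \<in> M"
  let ?f = "\<lambda>x. (if inv_into V \<psi> x \<in> U then u (\<phi> (inv_into V \<psi> x)) else 0)"
  define K where "K = inv_into U \<phi> ` cball a r"
  have "compact K"
    unfolding K_def
    by (intro compact_continuous_image continuous_on_subset[OF chart_cont_inv[OF U] assms(2)]) simp
  then have "open (- K)"
    by (simp add: compact_imp_closed open_Compl)
  have KU: "K \<subseteq> U"
    using assms(2) by (auto simp: K_def dest: subsetD intro: inv_into_into)
  have "Ck_on k (\<psi> ` (V \<inter> U)) ?f"
  proof (rule Ck_on_cong[OF chart_open_image[OF V chart_open[OF U]]])
    show "Ck_on k (\<psi> ` (V \<inter> U)) (\<lambda>x. u (\<phi> (inv_into V \<psi> x)))"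
      by (rule Ck_on_compose[OF chart_open_image[OF V chart_open[OF U]] _ transition_Ck_on[OF U V] u])
        (auto simp: chart_inv[OF V])
  qed (auto simp: chart_inv[OF V])
  moreover have "Ck_on k (\<psi> ` (V \<inter> - K)) ?f"
  proof (rule Ck_on_cong[OF chart_open_image[OF V \<open>open (- K)\<close>]])
    fix x assume "x \<in> \<psi> ` (V \<inter> - K)"
    then obtain q where q: "q \<in> V" "q \<notin> K" "x = \<psi> q" by auto
    have "\<phi> q \<notin> cball a r" if "q \<in> U"
      using q(2) chart_inv[OF U that] by (force simp: K_def)
    then show "0 = ?f x"
      using u0 q by (auto simp: chart_inv[OF V])
  qed (rule Ck_on_const)
  ultimately have "Ck_on k (\<psi> ` (V \<inter> U) \<union> \<psi> ` (V \<inter> - K)) ?f"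
    by (intro Ck_on_Un chart_open_image[OF V] chart_open[OF U] \<open>open (- K)\<close>)
  moreover have "\<psi> ` (V \<inter> U) \<union> \<psi> ` (V \<inter> - K) = \<psi> ` V"
    using KU by auto
  ultimately show "Ck_on k (\<psi> ` V) ?f" by simp
qed

lemma vector_fields_lincomb:
  assumes "X \<in> vector_fields M" "Y \<in> vector_fields M"
  shows "(\<lambda>q. a *\<^sub>R X q + b *\<^sub>R Y q) \<in> vector_fields M"
proof -
  have "a *\<^sub>R X q + b *\<^sub>R Y q \<in> tangent_space M q" for q
  proof -
    have "X q \<in> tangent_space M q" "Y q \<in> tangent_space M q"
      using assms by (auto simp: vector_fields_def)
    then show ?thesis
      unfolding tangent_space_def
      by (simp add: scaleR_fun_def algebra_simps)
  qed
  moreover have "(\<lambda>q. (a *\<^sub>R X q + b *\<^sub>R Y q) f) \<in> smooth_functions M"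
    if "f \<in> smooth_functions M" for f
    using that assms
    by (auto simp: scaleR_fun_def vector_fields_def intro: smooth_functions_lincomb)
  ultimately show ?thesis
    by (simp add: vector_fields_def)
qed

lemma smooth_functions_has_derivative:
  assumes "(U, \<phi>) \<in> M" "f \<in> smooth_functions M" "q \<in> U"
  shows "((\<lambda>x. f (inv_into U \<phi> x)) has_derivative
    frechet_derivative (\<lambda>x. f (inv_into U \<phi> x)) (at (\<phi> q))) (at (\<phi> q))"
proof -
  have "Ck_on (Suc 0) (\<phi> ` U) (\<lambda>x. f (inv_into U \<phi> x))"
    using assms(1,2) by (auto simp: smooth_functions_iff simp del: Ck_on.simps)
  from Ck_on_SucD(1)[OF this imageI[OF assms(3)]] show ?thesis .
qed

lemma cutoff_field_tangent:
  assumes U: "(U, \<phi>) \<in> M"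
  shows "cutoff_field M (U, \<phi>) \<beta> w q \<in> tangent_space M q"
proof (cases "q \<in> U")
  case False
  then show ?thesis
    by (auto simp: tangent_space_def cutoff_field_def)
next
  case q: True
  let ?d = "\<lambda>f. frechet_derivative (\<lambda>x. f (inv_into U \<phi> x)) (at (\<phi> q)) :: _ \<Rightarrow> real"
  have lin: "?d (\<lambda>q. a * f q + b * f' q) w = a * ?d f w + b * ?d f' w"
    and leib: "?d (\<lambda>q. f q * f' q) w = ?d f w * f' q + f q * ?d f' w"
    if "f \<in> smooth_functions M" "f' \<in> smooth_functions M" for f f' a b
  proof -
    note D = smooth_functions_has_derivative[OF U that(1) q]
      smooth_functions_has_derivative[OF U that(2) q]
    have "?d (\<lambda>q. a * f q + b * f' q) = (\<lambda>v. a * ?d f v + b * ?d f' v)"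
      by (rule frechet_derivative_at[symmetric],
          rule has_derivative_add[OF has_derivative_mult_right[OF D(1)]
            has_derivative_mult_right[OF D(2)]])
    then show "?d (\<lambda>q. a * f q + b * f' q) w = a * ?d f w + b * ?d f' w"
      by simp
    have "?d (\<lambda>q. f q * f' q) = (\<lambda>v. f (inv_into U \<phi> (\<phi> q)) * ?d f' v
        + ?d f v * f' (inv_into U \<phi> (\<phi> q)))"
      by (rule frechet_derivative_at[symmetric], rule has_derivative_mult[OF D])
    then show "?d (\<lambda>q. f q * f' q) w = ?d f w * f' q + f q * ?d f' w"
      by (simp add: chart_inv[OF U q])
  qed
  show ?thesis
    using q by (auto simp: tangent_space_def cutoff_field_def smooth_functions_lincomb
        smooth_functions_mult lin leib algebra_simps)
qed

lemma cutoff_field_bump: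
  assumes U: "(U, \<phi>) \<in> M" and "r > 0" "cball a r \<subseteq> \<phi> ` U"
  shows "cutoff_field M (U, \<phi>) (bump a r) w \<in> vector_fields M"
proof -
  have "(\<lambda>q. cutoff_field M (U, \<phi>) (bump a r) w q f) \<in> smooth_functions M"
    if f: "f \<in> smooth_functions M" for f
  proof -
    let ?u = "\<lambda>x. bump a r x * frechet_derivative (\<lambda>x. f (inv_into U \<phi> x)) (at x) w"
    have "Ck_on (Suc k) (\<phi> ` U) (\<lambda>x. f (inv_into U \<phi> x))" for k
      using f U by (auto simp: smooth_functions_iff simp del: Ck_on.simps)
    then have "Ck_on k (\<phi> ` U) ?u" for k
      by (intro Ck_on_mult chart_open_range[OF U] Ck_on_subset[OF Ck_on_bump] Ck_on_SucD) auto
    then have "(\<lambda>q. if q \<in> U then ?u (\<phi> q) else 0) \<in> smooth_functions M"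
      using assms by (intro smooth_functions_extend_by_zero) (auto simp: bump_outside)
    then show ?thesis
      using f by (simp add: cutoff_field_def cong: if_cong)
  qed
  then show ?thesis
    using cutoff_field_tangent[OF U] by (simp add: vector_fields_def)
qed

text \<open>As two vectors span the tangent space, two independent cutoff coordinate fields at p
  span it too, and a combination of them with constant coefficients passes through v. Independence
  is tested on the coordinate functions centred at p, themselves cut off to become global smooth
  functions.\<close>

lemma tangent_vector_extends:
  assumes "tangent_space M p = span {e1, e2}" and v: "v \<in> tangent_space M p"
  obtains X where "X \<in> vector_fields M" "X p = v"
proof -
  have "p \<in> (\<Union>(U, \<phi>)\<in>M. U)"
    using surf by (simp add: smooth_surface_def)
  then obtain U \<phi> where U: "(U, \<phi>) \<in> M" and p: "p \<in> U"
    by auto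
  obtain r where r: "r > 0" "cball (\<phi> p) r \<subseteq> \<phi> ` U"
    using chart_open_range[OF U] p open_contains_cball by blast
  let ?a = "\<phi> p" and ?\<beta> = "bump (\<phi> p) r"
  define E where "E = (\<lambda>i::2. cutoff_field M (U, \<phi>) ?\<beta> (axis i 1))"
  have E: "E i \<in> vector_fields M" for i
    unfolding E_def by (rule cutoff_field_bump[OF U r])
  then have E': "E i p \<in> tangent_space M p" for i
    by (simp add: vector_fields_def)
  define x where "x = (\<lambda>(j::2) q. if q \<in> U then ?\<beta> (\<phi> q) * (\<phi> q $ j - ?a $ j) else 0)"
  have x: "x j \<in> smooth_functions M" for j
  proof -
    have "Ck_on k (\<phi> ` U) (\<lambda>y. y $ j - ?a $ j)" for k
      using Ck_on_add[OF chart_open_range[OF U] Ck_on_bounded_linear[OF bounded_linear_vec_nth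
            chart_open_range[OF U] Ck_on_id[OF chart_open_range[OF U]]] Ck_on_const[of k _ "- (?a $ j)"]]
      by simp
    then have "Ck_on k (\<phi> ` U) (\<lambda>y. ?\<beta> y * (y $ j - ?a $ j))" for k
      by (intro Ck_on_mult chart_open_range[OF U] Ck_on_subset[OF Ck_on_bump]) auto
    then show ?thesis
      unfolding x_def using r U
      by (intro smooth_functions_extend_by_zero) (auto simp: bump_outside)
  qed
  \<comment> \<open>One factor \<open>?\<beta> ?a\<close> comes from the field and one from the
    cut-off coordinate. The derivative of the cutoff does not contribute, because the centred
    coordinate vanishes at p.\<close>
  have Ex: "E i p (x j) = (?\<beta> ?a)\<^sup>2 * (if i = j then 1 else 0)" for i j
  proof -
    obtain \<beta>' where \<beta>': "(?\<beta> has_derivative \<beta>') (at ?a)"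
      using Ck_on_SucD(1)[OF Ck_on_bump UNIV_I] by blast
    have "((\<lambda>y. y $ j - ?a $ j) has_derivative (\<lambda>v. v $ j)) (at ?a)"
      by (rule has_derivative_eq_rhs, rule has_derivative_diff[OF bounded_linear.has_derivative[OF
              bounded_linear_vec_nth has_derivative_ident] has_derivative_const]) simp
    from has_derivative_mult[OF \<beta>' this]
    have "((\<lambda>y. ?\<beta> y * (y $ j - ?a $ j)) has_derivative (\<lambda>v. ?\<beta> ?a * v $ j)) (at ?a)"
      by simp
    then have "((\<lambda>y. x j (inv_into U \<phi> y)) has_derivative (\<lambda>v. ?\<beta> ?a * v $ j)) (at ?a)"
      by (rule has_derivative_transform_within_open[OF _ chart_open_range[OF U] imageI[OF p]])
        (auto simp: x_def chart_inv[OF U])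
    then have "frechet_derivative (\<lambda>y. x j (inv_into U \<phi> y)) (at ?a) = (\<lambda>v. ?\<beta> ?a * v $ j)"
      by (rule frechet_derivative_at[symmetric])
    then show ?thesis
      using p x by (simp add: E_def cutoff_field_def axis_def power2_eq_square)
  qed
  have indep: "s = 0 \<and> t = 0" if "s *\<^sub>R E 1 p + t *\<^sub>R E 2 p = 0" for s t
  proof -
    have "s * E 1 p (x j) + t * E 2 p (x j) = 0" for j
      using fun_cong[OF that, of "x j"] by (simp add: scaleR_fun_def)
    from this[of 1] this[of 2] bump_center[OF r(1), of ?a] show ?thesis
      by (simp add: Ex)
  qed
  obtain s t where "v = s *\<^sub>R E 1 p + t *\<^sub>R E 2 p"
    using span_pair_exchange[OF E'[of 1, unfolded assms(1)] E'[of 2, unfolded assms(1)]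
        v[unfolded assms(1)] indep] by blast
  then show thesis
    using that[OF vector_fields_lincomb[OF E E]] by blast
qed

end


section \<open>The bundle E and its curvature\<close>

locale lorentzian_kaehler_surface =
  fixes M :: "'m::{t2_space, second_countable_topology} chart set"
    and g :: "'m \<Rightarrow> 'm tvec \<Rightarrow> 'm tvec \<Rightarrow> real"
    and nab :: "('m, 'm tvec) conn"
    and N :: "'m \<Rightarrow> 'v::real_vector set"
    and T :: "('m, 'v) trivialization set"
    and gN :: "'m \<Rightarrow> 'v \<Rightarrow> 'v \<Rightarrow> real"
    and D :: "('m, 'v) conn"
    and h :: "'m \<Rightarrow> 'm tvec \<Rightarrow> 'm tvec \<Rightarrow> 'v"
    and J :: "'m \<Rightarrow> 'm tvec \<times> 'v \<Rightarrow> 'm tvec \<times> 'v"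
    and Rt :: "'m \<Rightarrow> 'm tvec \<times> 'v \<Rightarrow> 'm tvec \<times> 'v \<Rightarrow> 'm tvec \<times> 'v \<Rightarrow> 'm tvec \<times> 'v \<Rightarrow> real"
  assumes surface: "lorentz_surface M g"
    and levi_civita: "levi_civita M g nab"
    and data: "lorentzian_kaehler_surface_data M g nab N T gN D h J Rt"
begin

section \<open>Connections, second fundamental form and shape operator\<close>

abbreviation "TM \<equiv> tangent_space M"
abbreviation "VF \<equiv> vector_fields M"
abbreviation "NS \<equiv> bundle_sections M N T"
abbreviation "A \<equiv> shape_operator M g gN h"

sublocale TM: lorentz_plane "TM p" "g p" for p
  using surface by unfold_locales (simp add: lorentz_surface_def lorentz_metric_def)

sublocale N: lorentz_plane "N p" "gN p" for p
  using data by unfold_locales (simp add: lorentzian_kaehler_surface_data_def lorentz_metric_def)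

lemma VF_mem [simp]: "X \<in> VF \<Longrightarrow> X p \<in> TM p"
  by (simp add: vector_fields_def)

lemma NS_mem [simp]: "s \<in> NS \<Longrightarrow> s p \<in> N p"
  by (simp add: bundle_sections_def)

lemma extend:
  assumes "v \<in> TM p"
  obtains X where "X \<in> VF" "X p = v"
proof -
  have "smooth_surface M"
    using surface by (simp add: lorentz_surface_def)
  moreover obtain e1 e2 where "TM p = span {e1, e2}"
    using TM.orthonormal_basis[of p] by metis
  ultimately show thesis
    using tangent_vector_extends[of M p e1 e2 v] assms that by blast
qed

lemma zero_VF [simp]: "(\<lambda>q. 0) \<in> VF"
proof -
  have "(\<lambda>q. 0) \<in> smooth_functions M"
    by (auto simp: smooth_functions_iff intro: Ck_on_const)
  then show ?thesis
    unfolding vector_fields_def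
    by (intro CollectI conjI allI ballI) (simp_all only: zero_fun_apply TM.zero_mem)
qed

lemma connection: "connection M N NS D" and connection_nab: "connection M TM VF nab"
  and compat: "metric_compatible M NS gN D"
  using data levi_civita by (simp_all add: lorentzian_kaehler_surface_data_def levi_civita_def)

lemma D_mem [simp]: "x \<in> TM p \<Longrightarrow> s \<in> NS \<Longrightarrow> D p x s \<in> N p"
  and D_section [simp]: "X \<in> VF \<Longrightarrow> s \<in> NS \<Longrightarrow> (\<lambda>q. D q (X q) s) \<in> NS"
  and D_add: "x \<in> TM p \<Longrightarrow> s \<in> NS \<Longrightarrow> t \<in> NS \<Longrightarrow> D p x (\<lambda>q. s q + t q) = D p x s + D p x t"
  using connection by (auto simp: connection_def)

lemma nab_mem [simp]: "x \<in> TM p \<Longrightarrow> Z \<in> VF \<Longrightarrow> nab p x Z \<in> TM p"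
  and nab_section [simp]: "X \<in> VF \<Longrightarrow> Z \<in> VF \<Longrightarrow> (\<lambda>q. nab q (X q) Z) \<in> VF"
  using connection_nab by (auto simp: connection_def)

text \<open>Since the connection is torsion-free, the bracket is a difference of tangent vectors; no
  separate proof that it is a derivation is needed.\<close>

lemma bracket: "X \<in> VF \<Longrightarrow> Y \<in> VF \<Longrightarrow> lie_bracket X Y p = nab p (X p) Y - nab p (Y p) X"
  using levi_civita by (simp add: levi_civita_def)

lemma bracket_mem [simp]: "X \<in> VF \<Longrightarrow> Y \<in> VF \<Longrightarrow> lie_bracket X Y p \<in> TM p"
  by (simp add: bracket TM.mem)

lemma second_fundamental_form: "second_fundamental_form M N T h"
  using data by (simp add: lorentzian_kaehler_surface_data_def)

lemma h_mem [simp]: "x \<in> TM p \<Longrightarrow> y \<in> TM p \<Longrightarrow> h p x y \<in> N p"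
  and h_sym: "x \<in> TM p \<Longrightarrow> y \<in> TM p \<Longrightarrow> h p x y = h p y x"
  and h_section [simp]: "X \<in> VF \<Longrightarrow> Y \<in> VF \<Longrightarrow> (\<lambda>q. h q (X q) (Y q)) \<in> NS"
  and h_linear: "y \<in> TM p \<Longrightarrow> linear_on (TM p) (\<lambda>x. h p x y)" "x \<in> TM p \<Longrightarrow> linear_on (TM p) (h p x)"
  using second_fundamental_form by (auto simp: second_fundamental_form_def bilinear_on_def)

lemmas h_diff_left = linear_on_diff[OF h_linear(1) TM.subsp]
  and h_diff_right = linear_on_diff[OF h_linear(2) TM.subsp]

lemma h_zero [simp]: "x \<in> TM p \<Longrightarrow> h p x 0 = 0"
  using linear_onD(3)[OF h_linear(2) TM.zero_mem] .

text \<open>The zero normal section is obtained as h of zero vector fields, so its smoothness is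
  inherited from that of h. It makes \<open>(Z, 0)\<close> a section of E.\<close>

lemma zero_NS [simp]: "(\<lambda>q. 0) \<in> NS"
  using h_section[OF zero_VF zero_VF] by (simp add: TM.mem)

lemma D_zero [simp]: "x \<in> TM p \<Longrightarrow> D p x (\<lambda>q. 0) = 0"
  using D_add[of x p "\<lambda>q. 0" "\<lambda>q. 0"] by simp

lemma shape_operator:
  assumes "\<xi> \<in> N p" "x \<in> TM p"
  shows A_mem [simp]: "A p \<xi> x \<in> TM p"
    and g_A: "y \<in> TM p \<Longrightarrow> g p (A p \<xi> x) y = gN p (h p x y) \<xi>"
proof -
  have "linear_on (TM p) (\<lambda>y. gN p (h p x y) \<xi>)"
    using assms linear_onD(1,2)[OF h_linear(2)[OF assms(2)]]
    by (simp add: linear_on_def N.lefts)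
  from theI'[OF TM.riesz[OF this]]
  show "A p \<xi> x \<in> TM p" "y \<in> TM p \<Longrightarrow> g p (A p \<xi> x) y = gN p (h p x y) \<xi>"
    by (simp_all add: shape_operator_def E_metric_def nor_def TM.zero_left TM.mem)
qed

lemma A_zero [simp]: "x \<in> TM p \<Longrightarrow> A p 0 x = 0"
  by (rule TM.nondegenerate[of _ p]) (simp_all add: N.mem g_A N.rights)

section \<open>The bundle E with its metric, complex structure and connection\<close>

lemma complex_structure: "parallel_complex_structure M g nab N T gN D h J"
  using data by (simp add: lorentzian_kaehler_surface_data_def)

abbreviation "E \<equiv> E_fibre M N"
abbreviation "ES \<equiv> E_sections M N T"
abbreviation "gE \<equiv> E_metric g gN"
abbreviation "EC \<equiv> E_connection M g nab gN D h"

lemma E_iff [simp]: "(x, \<xi>) \<in> E p \<longleftrightarrow> x \<in> TM p \<and> \<xi> \<in> N p"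
  by (simp add: E_fibre_def)

lemma ES_iff [simp]: "(\<lambda>q. (X q, \<xi> q)) \<in> ES \<longleftrightarrow> X \<in> VF \<and> \<xi> \<in> NS"
  by (simp add: E_sections_def)

lemma gE_pair [simp]: "gE p (x, \<xi>) (y, \<eta>) = g p x y + gN p \<xi> \<eta>"
  by (simp add: E_metric_def)

lemma E_subspace: "subspace (E p)"
  unfolding E_fibre_def by (intro subspace_Times TM.subsp N.subsp)

lemma J_linear: "linear_on (E p) (J p)"
  and J_mem: "\<sigma> \<in> E p \<Longrightarrow> J p \<sigma> \<in> E p"
  and J_J: "\<sigma> \<in> E p \<Longrightarrow> J p (J p \<sigma>) = - \<sigma>"
  and J_isometry: "\<sigma> \<in> E p \<Longrightarrow> \<tau> \<in> E p \<Longrightarrow> gE p (J p \<sigma>) (J p \<tau>) = gE p \<sigma> \<tau>"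
  and J_section: "s \<in> ES \<Longrightarrow> (\<lambda>q. J q (s q)) \<in> ES"
  and J_parallel: "x \<in> TM p \<Longrightarrow> s \<in> ES \<Longrightarrow> EC p x (\<lambda>q. J q (s q)) = J p (EC p x s)"
  using complex_structure by (auto simp: parallel_complex_structure_def)

lemma J_skew:
  assumes "\<sigma> \<in> E p" "\<tau> \<in> E p"
  shows "gE p (J p \<sigma>) \<tau> = - gE p \<sigma> (J p \<tau>)"
proof -
  have "gE p (J p \<sigma>) \<tau> = gE p (J p (J p \<sigma>)) (J p \<tau>)"
    using assms by (simp add: J_isometry J_mem)
  also have "\<dots> = gE p (- \<sigma>) (J p \<tau>)"
    using assms by (simp add: J_J)
  also have "\<dots> = - gE p \<sigma> (J p \<tau>)"
    using assms J_mem[OF assms(2)]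
    by (cases \<sigma>; cases "J p \<tau>") (simp add: TM.lefts N.lefts)
  finally show ?thesis .
qed

lemma EC_pair:
  "EC p x (\<lambda>q. (Z q, \<xi> q)) = (nab p x Z - A p (\<xi> p) x, h p x (Z p) + D p x \<xi>)"
  by (simp add: E_connection_def tang_def nor_def)

section \<open>The ambient curvature tensor\<close>

lemma curvature_tensor: "kaehler_curvature_tensor M N T J Rt"
  using data by (simp add: lorentzian_kaehler_surface_data_def)

lemma
  assumes "x \<in> E p" "y \<in> E p" "z \<in> E p"
  shows Rt_linear: "linear_on (E p) (\<lambda>w. Rt p x y w z)" "linear_on (E p) (Rt p x y z)"
    and Rt_J: "w \<in> E p \<Longrightarrow> Rt p x y (J p z) w = - Rt p x y z (J p w)"
    and Rt_skew: "w \<in> E p \<Longrightarrow> Rt p x y z w = - Rt p x y w z"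
proof -
  show "linear_on (E p) (\<lambda>w. Rt p x y w z)" "linear_on (E p) (Rt p x y z)"
    "w \<in> E p \<Longrightarrow> Rt p x y (J p z) w = - Rt p x y z (J p w)"
    using curvature_tensor assms unfolding kaehler_curvature_tensor_def by blast+
  assume "w \<in> E p"
  \<comment> \<open>Pair symmetry carries the skewness of the first two slots over to the last
    two.\<close>
  then have "Rt p x y z w = Rt p z w x y" "Rt p z w x y = - Rt p w z x y"
    "Rt p x y w z = Rt p w z x y"
    using curvature_tensor assms unfolding kaehler_curvature_tensor_def by blast+
  then show "Rt p x y z w = - Rt p x y w z" by simp
qed

lemma not_complex_tangent:
  obtains Z where "Z \<in> VF" "snd (J p (Z p, 0)) \<noteq> 0"
proof -
  have "\<exists>x\<in>TM p. snd (J p (x, 0)) \<noteq> 0"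
  proof (rule ccontr)
    assume "\<not> ?thesis"
    then have J: "J p (x, 0) = (fst (J p (x, 0)), 0)" if "x \<in> TM p" for x
      using that by (metis prod.collapse)
    have mem: "(x, 0) \<in> E p" if "x \<in> TM p" for x
      using that by (simp add: N.mem)
    show False
    proof (rule TM.no_orthogonal_complex_structure[of p "\<lambda>x. fst (J p (x, 0))"])
      fix x assume x: "x \<in> TM p"
      show "fst (J p (x, 0)) \<in> TM p"
        using J_mem[OF mem[OF x]] by (auto simp: E_fibre_def)
      show "g p (fst (J p (x, 0))) (fst (J p (x, 0))) = g p x x"
        using J_isometry[OF mem[OF x] mem[OF x]] J[OF x] by (metis add_right_cancel gE_pair)
      \<comment> \<open>Skewness of J together with symmetry of the metric: a vector is orthogonal
        to its image.\<close>
      have "gE p (J p (x, 0)) (x, 0) = - gE p (J p (x, 0)) (x, 0)"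
        using J_skew[OF mem[OF x] mem[OF x]] J_mem[OF mem[OF x]] x
        by (cases "J p (x, 0)") (simp add: TM.sym N.lefts N.rights N.mem)
      then have "gE p (J p (x, 0)) (x, 0) = 0" by simp
      then have "g p (fst (J p (x, 0))) x + gN p 0 0 = 0"
        using J[OF x] gE_pair by metis
      then show "g p (fst (J p (x, 0))) x = 0"
        by (simp add: N.lefts N.mem)
    qed
  qed
  then show thesis
    using extend that by metis
qed

text \<open>The equation of Codazzi speaks of a vector given by a definite description. Its
  existence and uniqueness on E come from \<open>riesz\<close> applied to the tangent and normal
  summands separately.\<close>

lemma curvature_vector_normal:
  assumes "x \<in> E p" "y \<in> E p" "z \<in> E p" "\<eta> \<in> N p"
  defines "v \<equiv> curvature_vector M g N gN Rt p x y z"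
  shows "snd v \<in> N p" "gN p (snd v) \<eta> = Rt p x y z (nor \<eta>)"
proof -
  let ?f = "Rt p x y z"
  have f: "linear_on (E p) ?f"
    using assms by (simp add: Rt_linear)
  have "linear_on (TM p) (\<lambda>u. ?f (u, 0))"
    using linear_onD(1)[OF f, of "(_, 0)" "(_, 0)"] linear_onD(2)[OF f, of "(_, 0)"]
    by (simp add: linear_on_def N.mem)
  from TM.riesz[OF this] obtain v1 where v1: "v1 \<in> TM p" "\<And>u. u \<in> TM p \<Longrightarrow> g p v1 u = ?f (u, 0)"
    by blast
  have "linear_on (N p) (\<lambda>u. ?f (0, u))"
    using linear_onD(1)[OF f, of "(0, _)" "(0, _)"] linear_onD(2)[OF f, of "(0, _)"]
    by (simp add: linear_on_def TM.mem)
  from N.riesz[OF this] obtain v2 where v2: "v2 \<in> N p" "\<And>u. u \<in> N p \<Longrightarrow> gN p v2 u = ?f (0, u)"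
    by blast
  have "\<exists>!v. v \<in> E p \<and> (\<forall>w\<in>E p. gE p v w = ?f w)"
  proof (rule ex_ex1I)
    have "gE p (v1, v2) (u, \<nu>) = ?f (u, \<nu>)" if "u \<in> TM p" "\<nu> \<in> N p" for u \<nu>
      using that v1 v2 linear_onD(1)[OF f, of "(u, 0)" "(0, \<nu>)"] by (simp add: N.mem TM.mem)
    then show "\<exists>v. v \<in> E p \<and> (\<forall>w\<in>E p. gE p v w = ?f w)"
      using v1 v2 by (intro exI[of _ "(v1, v2)"]) (auto simp: E_fibre_def)
  next
    fix a c
    assume "a \<in> E p \<and> (\<forall>w\<in>E p. gE p a w = ?f w)" "c \<in> E p \<and> (\<forall>w\<in>E p. gE p c w = ?f w)"
    then have ac: "a \<in> E p" "c \<in> E p" and eq: "\<And>w. w \<in> E p \<Longrightarrow> gE p a w = gE p c w"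
      by auto
    obtain a1 a2 c1 c2 where [simp]: "a = (a1, a2)" "c = (c1, c2)"
      by (cases a; cases c)
    have "a1 - c1 = 0"
      using ac eq[of "(_, 0)"]
      by (intro TM.nondegenerate[of _ p]) (auto simp: TM.mem TM.lefts N.mem N.rights)
    moreover have "a2 - c2 = 0"
      using ac eq[of "(0, _)"]
      by (intro N.nondegenerate[of _ p]) (auto simp: N.mem N.lefts TM.mem TM.rights)
    ultimately show "a = c" by simp
  qed
  from theI'[OF this] have "v \<in> E p" "gE p v (nor \<eta>) = ?f (nor \<eta>)"
    using assms(4) by (simp_all add: v_def curvature_vector_def nor_def TM.mem)
  then show "snd v \<in> N p" "gN p (snd v) \<eta> = ?f (nor \<eta>)"
    by (cases v; simp add: nor_def TM.rights)+
qed

section \<open>The defect in the equation of Ricci as a skew form on the normal plane\<close>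

lemma normal_curvature_skew:
  assumes "X \<in> VF" "Y \<in> VF" "\<xi> \<in> NS" "\<eta> \<in> NS"
  shows "gN p (curvature D X Y \<xi> p) (\<eta> p) = - gN p (curvature D X Y \<eta> p) (\<xi> p)"
proof -
  have smooth: "(\<lambda>q. gN q (s q) (t q)) \<in> smooth_functions M" if "s \<in> NS" "t \<in> NS" for s t
    using data that by (simp add: lorentzian_kaehler_surface_data_def lorentz_metric_def)
  have comp: "x (\<lambda>q. gN q (s q) (t q)) = gN p (D p x s) (t p) + gN p (s p) (D p x t)"
    if "x \<in> TM p" "s \<in> NS" "t \<in> NS" for p x s t
    using compat that by (simp add: metric_compatible_def)
  \<comment> \<open>Smoothness is essential here: tangent vectors are additive on smooth functions
    and 0 by convention on all others.\<close>
  have add: "x (\<lambda>q. u q + w q) = x u + x w"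
    if x: "x \<in> TM p" and "u \<in> smooth_functions M" "w \<in> smooth_functions M" for x u w
  proof -
    have "x (\<lambda>q. 1 * u q + 1 * w q) = 1 * x u + 1 * x w"
      using that unfolding tangent_space_def by blast
    then show ?thesis by simp
  qed
  \<comment> \<open>The two middle terms are exchanged by swapping W and Z. They cancel in the
    commutator of X and Y, and subtracting the bracket term leaves exactly the two curvature
    terms.\<close>
  have second: "W p (\<lambda>q. Z q (\<lambda>q. gN q (\<xi> q) (\<eta> q)))
      = gN p (D p (W p) (\<lambda>q. D q (Z q) \<xi>)) (\<eta> p) + gN p (D p (Z p) \<xi>) (D p (W p) \<eta>)
        + gN p (D p (W p) \<xi>) (D p (Z p) \<eta>) + gN p (\<xi> p) (D p (W p) (\<lambda>q. D q (Z q) \<eta>))"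
    if "W \<in> VF" "Z \<in> VF" for W Z
  proof -
    have "Z q (\<lambda>q. gN q (\<xi> q) (\<eta> q))
        = gN q (D q (Z q) \<xi>) (\<eta> q) + gN q (\<xi> q) (D q (Z q) \<eta>)" for q
      using that assms by (intro comp) auto
    then have "W p (\<lambda>q. Z q (\<lambda>q. gN q (\<xi> q) (\<eta> q)))
        = W p (\<lambda>q. gN q (D q (Z q) \<xi>) (\<eta> q) + gN q (\<xi> q) (D q (Z q) \<eta>))"
      by (simp only:)
    also have "\<dots> = W p (\<lambda>q. gN q (D q (Z q) \<xi>) (\<eta> q)) + W p (\<lambda>q. gN q (\<xi> q) (D q (Z q) \<eta>))"
      using that assms by (intro add[OF VF_mem] smooth D_section)
    finally show ?thesis
      using that assms comp[of "W p" p "\<lambda>q. D q (Z q) \<xi>" \<eta>]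
        comp[of "W p" p \<xi> "\<lambda>q. D q (Z q) \<eta>"] by simp
  qed
  have "lie_bracket X Y p (\<lambda>q. gN q (\<xi> q) (\<eta> q))
      = X p (\<lambda>q. Y q (\<lambda>q. gN q (\<xi> q) (\<eta> q))) - Y p (\<lambda>q. X q (\<lambda>q. gN q (\<xi> q) (\<eta> q)))"
    by (simp add: lie_bracket_def)
  moreover have "lie_bracket X Y p (\<lambda>q. gN q (\<xi> q) (\<eta> q))
      = gN p (D p (lie_bracket X Y p) \<xi>) (\<eta> p) + gN p (\<xi> p) (D p (lie_bracket X Y p) \<eta>)"
    using assms by (intro comp) auto
  ultimately have "gN p (curvature D X Y \<xi> p) (\<eta> p) + gN p (\<xi> p) (curvature D X Y \<eta> p) = 0"
    using assms second[of X Y] second[of Y X]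
    by (simp add: curvature_def N.diff_left N.diff_right N.mem)
  moreover have "curvature D X Y \<eta> p \<in> N p"
    using assms by (simp add: curvature_def N.mem)
  ultimately show ?thesis
    using assms by (simp add: N.sym)
qed

text \<open>The normal part of the curvature of the connection on \<^term>\<open>E\<close>, applied to the section
  \<^term>\<open>\<xi>\<close> of the normal bundle.\<close>

definition ricci_vector where
  "ricci_vector X Y \<xi> p = curvature D X Y \<xi> p
    - h p (X p) (A p (\<xi> p) (Y p)) + h p (Y p) (A p (\<xi> p) (X p))"

text \<open>The form S of the overview, restricted to the normal bundle.\<close>

definition ricci_defect where
  "ricci_defect X Y \<xi> \<eta> p = gN p (ricci_vector X Y \<xi> p) (\<eta> p)
    - Rt p (tang (X p)) (tang (Y p)) (nor (\<xi> p)) (nor (\<eta> p))"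

lemma tang_mem [simp]: "x \<in> TM p \<Longrightarrow> tang x \<in> E p"
  and nor_mem [simp]: "\<xi> \<in> N p \<Longrightarrow> nor \<xi> \<in> E p"
  by (simp_all add: tang_def nor_def TM.mem N.mem)

lemma ricci_vector_mem [simp]: "X \<in> VF \<Longrightarrow> Y \<in> VF \<Longrightarrow> \<xi> \<in> NS \<Longrightarrow> ricci_vector X Y \<xi> p \<in> N p"
  by (simp add: ricci_vector_def curvature_def N.mem)

text \<open>In this form the shape operator terms are visibly skew under the exchange of \<xi> and
  \<eta>, by symmetry of g.\<close>

lemma gN_ricci_vector:
  assumes "X \<in> VF" "Y \<in> VF" "\<xi> \<in> NS" "\<eta> \<in> N p"
  shows "gN p (ricci_vector X Y \<xi> p) \<eta> = gN p (curvature D X Y \<xi> p) \<eta>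
    - g p (A p \<eta> (X p)) (A p (\<xi> p) (Y p)) + g p (A p \<eta> (Y p)) (A p (\<xi> p) (X p))"
proof -
  have "curvature D X Y \<xi> p \<in> N p"
    using assms by (simp add: curvature_def N.mem)
  then show ?thesis
    using assms by (simp add: ricci_vector_def N.lefts N.mem g_A)
qed

lemma ricci_equation_iff:
  "ricci_equation M g N T gN D h Rt \<longleftrightarrow>
    (\<forall>p. \<forall>X\<in>VF. \<forall>Y\<in>VF. \<forall>\<xi>\<in>NS. \<forall>\<eta>\<in>NS. ricci_defect X Y \<xi> \<eta> p = 0)"
proof -
  have "gE p (nor (curvature D X Y \<xi> p)) (nor (\<eta> p)) =
      Rt p (tang (X p)) (tang (Y p)) (nor (\<xi> p)) (nor (\<eta> p))
      + g p (A p (\<xi> p) (A p (\<eta> p) (X p)) - A p (\<eta> p) (A p (\<xi> p) (X p))) (Y p)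
      \<longleftrightarrow> ricci_defect X Y \<xi> \<eta> p = 0"
    if "X \<in> VF" "Y \<in> VF" "\<xi> \<in> NS" "\<eta> \<in> NS" for X Y \<xi> \<eta> p
  proof -
    \<comment> \<open>Symmetry of h makes each shape operator self-adjoint, which turns the
      commutator term into the products of \<open>gN_ricci_vector\<close>.\<close>
    have self_adjoint: "g p (A p \<alpha> x) y = g p x (A p \<alpha> y)"
      if "\<alpha> \<in> N p" "x \<in> TM p" "y \<in> TM p" for \<alpha> x y
      using that by (simp add: TM.sym[of x] g_A h_sym)
    have "g p (A p (\<xi> p) (A p (\<eta> p) (X p)) - A p (\<eta> p) (A p (\<xi> p) (X p))) (Y p)
        = g p (A p (\<eta> p) (X p)) (A p (\<xi> p) (Y p)) - g p (A p (\<eta> p) (Y p)) (A p (\<xi> p) (X p))"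
      using that by (simp add: TM.diff_left self_adjoint[of "\<xi> p" "A p (\<eta> p) (X p)"]
          self_adjoint[of "\<eta> p" "A p (\<xi> p) (X p)"] TM.sym[of "A p (\<xi> p) (X p)"])
    then show ?thesis
      using that by (auto simp: ricci_defect_def gN_ricci_vector nor_def E_metric_def
          TM.zero_left TM.mem)
  qed
  then show ?thesis
    by (simp add: ricci_equation_def Let_def)
qed

lemma ricci_defect_skew:
  assumes "X \<in> VF" "Y \<in> VF" "\<xi> \<in> NS" "\<eta> \<in> NS"
  shows "ricci_defect X Y \<xi> \<eta> p = - ricci_defect X Y \<eta> \<xi> p"
  using assms normal_curvature_skew[OF assms, of p]
    Rt_skew[of "tang (X p)" p "tang (Y p)" "nor (\<xi> p)" "nor (\<eta> p)"]
  by (simp add: ricci_defect_def gN_ricci_vector TM.sym)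

text \<open>The second section enters only through its value at p, so a linear relation at that
  single point suffices. The first section is differentiated; linearity there is reached through
  skewness.\<close>

lemma ricci_defect_lincomb:
  assumes "X \<in> VF" "Y \<in> VF" "\<xi> \<in> NS" "\<eta> \<in> NS" "\<eta>1 \<in> NS" "\<eta>2 \<in> NS"
    and "\<eta> p = a *\<^sub>R \<eta>1 p + b *\<^sub>R \<eta>2 p"
  shows "ricci_defect X Y \<xi> \<eta> p = a * ricci_defect X Y \<xi> \<eta>1 p + b * ricci_defect X Y \<xi> \<eta>2 p"
proof -
  let ?f = "Rt p (tang (X p)) (tang (Y p)) (nor (\<xi> p))"
  have f: "linear_on (E p) ?f"
    using assms by (simp add: Rt_linear)
  have "?f (nor (\<eta> p)) = ?f (a *\<^sub>R nor (\<eta>1 p) + b *\<^sub>R nor (\<eta>2 p))"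
    by (simp add: assms(7) nor_def)
  also have "\<dots> = a * ?f (nor (\<eta>1 p)) + b * ?f (nor (\<eta>2 p))"
    using assms(5,6) by (simp add: linear_onD(1,2)[OF f] subspace_scale[OF E_subspace])
  finally show ?thesis
    using assms by (simp add: ricci_defect_def N.rights N.mem algebra_simps)
qed

lemma ricci_defect_eq_0:
  assumes "X \<in> VF" "Y \<in> VF" "\<zeta> \<in> NS" "\<zeta> p \<noteq> 0"
    and \<zeta>: "\<And>\<eta>. \<eta> \<in> NS \<Longrightarrow> ricci_defect X Y \<zeta> \<eta> p = 0"
    and "\<xi> \<in> NS" "\<eta> \<in> NS"
  shows "ricci_defect X Y \<xi> \<eta> p = 0"
proof -
  note skew = ricci_defect_skew[OF assms(1,2)] and lin = ricci_defect_lincomb[OF assms(1,2)]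
  consider c where "\<xi> p = c *\<^sub>R \<zeta> p" | s t where "\<eta> p = s *\<^sub>R \<zeta> p + t *\<^sub>R \<xi> p"
    by (rule N.rank_2[of "\<zeta> p" p "\<xi> p" "\<eta> p"]) (use assms in auto)
  then show ?thesis
  proof cases
    case (1 c)
    \<comment> \<open>The relation between \<xi> and \<zeta> holds only at p, so \<xi> is first
      moved to the slot that is not differentiated.\<close>
    then have "ricci_defect X Y \<eta> \<xi> p = c * ricci_defect X Y \<eta> \<zeta> p"
      using lin[of \<eta> \<xi> \<zeta> \<zeta> p c 0] assms by simp
    then show ?thesis
      using skew[of \<xi> \<eta> p] skew[of \<eta> \<zeta> p] \<zeta> assms by simp
  next
    case (2 s t)
    have "ricci_defect X Y \<xi> \<eta> p = s * ricci_defect X Y \<xi> \<zeta> p + t * ricci_defect X Y \<xi> \<xi> p"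
      using lin[of \<xi> \<eta> \<zeta> \<xi> p s t] 2 assms by simp
    then show ?thesis
      using skew[of \<xi> \<xi> p] skew[of \<xi> \<zeta> p] \<zeta> assms by simp
  qed
qed

section \<open>The equations of Gauss and Codazzi transported through J\<close>

text \<open>Replacing the derivative of \<open>J Z\<close> by \<open>J\<close> applied to the derivative of \<open>Z\<close> before
  differentiating again avoids any appeal to smoothness of the shape operator.\<close>

lemma ricci_defect_normal_part:
  assumes gauss: "gauss_equation M g nab gN h Rt"
    and codazzi: "codazzi_equation M g nab N gN D h Rt"
    and X: "X \<in> VF" and Y: "Y \<in> VF" and Z: "Z \<in> VF" and \<eta>: "\<eta> \<in> NS"
  defines "F \<equiv> \<lambda>q. snd (J q (Z q, 0))"
  shows "F \<in> NS" "ricci_defect X Y F \<eta> p = 0"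
proof -
  define P where "P = (\<lambda>q. fst (J q (Z q, 0)))"
  have JZ: "J q (Z q, 0) = (P q, F q)" for q
    by (simp add: P_def F_def)
  have "(\<lambda>q. (P q, F q)) \<in> ES"
    using J_section[of "\<lambda>q. (Z q, 0)"] Z by (simp add: JZ)
  then have P: "P \<in> VF" and F: "F \<in> NS" by simp_all
  show "F \<in> NS" by (rule F)
  let ?cod = "\<lambda>Z. cov_deriv_h nab D h X Y Z p - cov_deriv_h nab D h Y X Z p"
  let ?B = "lie_bracket X Y"
  let ?Rt = "Rt p (tang (X p)) (tang (Y p))"

  have J_EC: "J q (nab q x Z, h q x (Z q)) = (nab q x P - A q (F q) x, h q x (P q) + D q x F)"
    if "x \<in> TM q" for q x
    using J_parallel[of x q "\<lambda>q. (Z q, 0)"] Z that by (simp add: JZ EC_pair)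
  \<comment> \<open>The derivative of \<open>(Z, 0)\<close> along W. Since the normal part is 0 no
    shape operator occurs, and smoothness is immediate.\<close>
  define \<sigma> where "\<sigma> = (\<lambda>W q. (nab q (W q) Z, h q (W q) (Z q)))"
  have \<sigma>: "\<sigma> W \<in> ES" if "W \<in> VF" for W
    using that Z by (simp add: \<sigma>_def)
  have EC_\<sigma>: "EC p (V p) (\<sigma> W) = (nab p (V p) (\<lambda>q. nab q (W q) Z) - A p (h p (W p) (Z p)) (V p),
      h p (V p) (nab p (W p) Z) + D p (V p) (\<lambda>q. h q (W q) (Z q)))" for V W
    by (simp add: \<sigma>_def EC_pair)
  have EC_mem: "EC p (V p) (\<sigma> W) \<in> E p" if "V \<in> VF" "W \<in> VF" for V W
    using that Z by (simp add: EC_\<sigma> TM.mem N.mem)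
  have J_EC_\<sigma>: "snd (J p (EC p (V p) (\<sigma> W))) = h p (V p) (nab p (W p) P)
      - h p (V p) (A p (F p) (W p)) + D p (V p) (\<lambda>q. h q (W q) (P q)) + D p (V p) (\<lambda>q. D q (W q) F)"
    if V: "V \<in> VF" and W: "W \<in> VF" for V W
  proof -
    have "J p (EC p (V p) (\<sigma> W)) = EC p (V p) (\<lambda>q. J q (\<sigma> W q))"
      using J_parallel[OF _ \<sigma>[OF W]] V by simp
    also have "\<dots> = EC p (V p) (\<lambda>q. (nab q (W q) P - A q (F q) (W q), h q (W q) (P q) + D q (W q) F))"
      using W by (simp add: \<sigma>_def J_EC)
    \<comment> \<open>Taking \<open>snd\<close> discards the tangent component, where the derivative
      of the shape operator term would appear.\<close>
    finally show ?thesis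
      using V W P F by (simp add: EC_pair D_add h_diff_right)
  qed

  \<comment> \<open>The curvature of \<open>EC\<close> applied to \<open>Z\<close>.\<close>
  define K where "K = EC p (X p) (\<sigma> Y) - EC p (Y p) (\<sigma> X) - (nab p (?B p) Z, h p (?B p) (Z p))"
  have B_mem: "(nab p (?B p) Z, h p (?B p) (Z p)) \<in> E p"
    using X Y Z by simp
  have K_mem: "K \<in> E p"
    unfolding K_def using X Y by (intro subspace_diff[OF E_subspace] EC_mem B_mem)
  \<comment> \<open>Torsion-freeness splits the term h([X,Y], Z) into the two terms that the
    covariant derivatives of h require.\<close>
  have K: "K = (curvature nab X Y Z p - A p (h p (Y p) (Z p)) (X p) + A p (h p (X p) (Z p)) (Y p), ?cod Z)"
    using X Y Z by (simp add: K_def EC_\<sigma> curvature_def cov_deriv_h_def bracket h_diff_left)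
  have JK: "J p K = J p (EC p (X p) (\<sigma> Y)) - J p (EC p (Y p) (\<sigma> X)) - J p (nab p (?B p) Z, h p (?B p) (Z p))"
    unfolding K_def using X Y B_mem
    by (simp add: linear_on_diff[OF J_linear E_subspace] subspace_diff[OF E_subspace] EC_mem)
  have "snd (J p K) = snd (J p (EC p (X p) (\<sigma> Y))) - snd (J p (EC p (Y p) (\<sigma> X)))
      - (h p (?B p) (P p) + D p (?B p) F)"
    using X Y by (simp add: JK J_EC)
  \<comment> \<open>By parallelism of J this is the normal part of the curvature of
    \<open>EC\<close> on \<open>(P, F)\<close>: F contributes the Ricci vector and P the Codazzi
    expression.\<close>
  then have snd_JK: "snd (J p K) = ricci_vector X Y F p + ?cod P"
    using X Y Z P F
    by (simp add: J_EC_\<sigma> ricci_vector_def curvature_def cov_deriv_h_def bracket h_diff_left)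

  have cod: "?cod W \<in> N p" "gN p (?cod W) \<nu> = ?Rt (tang (W p)) (nor \<nu>)"
    if "W \<in> VF" "\<nu> \<in> N p" for W \<nu>
    using curvature_vector_normal[of "tang (X p)" p "tang (Y p)" "tang (W p)" \<nu>] codazzi X Y that
    by (simp_all add: codazzi_equation_def)
  have gE_K: "gE p K \<tau> = ?Rt (tang (Z p)) \<tau>" if \<tau>: "\<tau> \<in> E p" for \<tau>
  proof -
    obtain w \<nu> where \<tau>_eq: "\<tau> = (w, \<nu>)" and w: "w \<in> TM p" and \<nu>: "\<nu> \<in> N p"
      using \<tau> by (cases \<tau>) auto
    \<comment> \<open>The equation of Gauss is quantified over vector fields, so the tangent vector
      w has to be extended.\<close>
    obtain W where W: "W \<in> VF" "W p = w"
      using extend[OF w] by blast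
    have "g p (curvature nab X Y Z p) w = ?Rt (tang (Z p)) (tang w)
        + gN p (h p (X p) w) (h p (Y p) (Z p)) - gN p (h p (X p) (Z p)) (h p (Y p) w)"
      using gauss X Y Z W
      by (auto simp: gauss_equation_def nor_def E_metric_def TM.zero_left TM.mem)
    moreover have "curvature nab X Y Z p \<in> TM p"
      using X Y Z by (simp add: curvature_def TM.mem)
    \<comment> \<open>The shape operator terms of K cancel the h terms of the equation of Gauss,
      while the equation of Codazzi identifies the normal component.\<close>
    ultimately have "gE p K \<tau> = ?Rt (tang (Z p)) (tang w) + ?Rt (tang (Z p)) (nor \<nu>)"
      unfolding K \<tau>_eq gE_pair using X Y Z w \<nu> cod(2)[OF Z \<nu>]
      by (simp add: TM.lefts TM.mem g_A N.sym)
    also have "\<dots> = ?Rt (tang (Z p)) (tang w + nor \<nu>)"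
      using X Y Z w \<nu> by (simp add: linear_onD(1)[OF Rt_linear(2)])
    finally show ?thesis
      by (simp add: \<tau>_eq tang_def nor_def)
  qed

  have n: "nor (\<eta> p) \<in> E p" using \<eta> by simp
  \<comment> \<open>J moves from K to \<eta> by skewness for the metric, then from \<eta> to Z by
    the Kaehler identity of \<open>Rt\<close>; the two signs cancel. The P term is finally matched
    by the equation of Codazzi for P, leaving the defect of F.\<close>
  have "gN p (snd (J p K)) (\<eta> p) = gE p (J p K) (nor (\<eta> p))"
    using J_mem[OF K_mem] by (cases "J p K") (simp add: nor_def TM.rights)
  also have "\<dots> = - ?Rt (tang (Z p)) (J p (nor (\<eta> p)))"
    using J_skew[OF K_mem n] gE_K[OF J_mem[OF n]] by simp
  also have "\<dots> = ?Rt (J p (tang (Z p))) (nor (\<eta> p))"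
    using Rt_J[OF _ _ _ n] X Y Z by simp
  also have "J p (tang (Z p)) = tang (P p) + nor (F p)"
    using JZ[of p] by (simp add: tang_def nor_def)
  also have "?Rt (tang (P p) + nor (F p)) (nor (\<eta> p))
      = ?Rt (tang (P p)) (nor (\<eta> p)) + ?Rt (nor (F p)) (nor (\<eta> p))"
    using X Y P F \<eta> linear_onD(1)[OF Rt_linear(1)[OF tang_mem tang_mem n]] by simp
  finally show "ricci_defect X Y F \<eta> p = 0"
    using X Y P F \<eta> cod[OF P, of "\<eta> p"] by (simp add: ricci_defect_def snd_JK N.add_left)
qed

lemma gauss_codazzi_imp_ricci:
  assumes "gauss_equation M g nab gN h Rt" "codazzi_equation M g nab N gN D h Rt"
  shows "ricci_equation M g N T gN D h Rt"
  unfolding ricci_equation_iff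
proof (intro allI ballI)
  fix p X Y \<xi> \<eta>
  assume *: "X \<in> VF" "Y \<in> VF" "\<xi> \<in> NS" "\<eta> \<in> NS"
  obtain Z where Z: "Z \<in> VF" "snd (J p (Z p, 0)) \<noteq> 0"
    by (rule not_complex_tangent)
  note F = ricci_defect_normal_part[OF assms *(1,2) Z(1)]
  show "ricci_defect X Y \<xi> \<eta> p = 0"
    using ricci_defect_eq_0[OF *(1,2) F(1)[OF *(4)] Z(2) F(2) *(3,4)] .
qed

end

theorem theorem3p1:
  fixes M :: "'m::{t2_space, second_countable_topology} chart set"
    and g :: "'m \<Rightarrow> 'm tvec \<Rightarrow> 'm tvec \<Rightarrow> real"
    and nab :: "('m, 'm tvec) conn"
    and N :: "'m \<Rightarrow> 'v::real_vector set"
    and T :: "('m, 'v) trivialization set"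
    and gN :: "'m \<Rightarrow> 'v \<Rightarrow> 'v \<Rightarrow> real"
    and D :: "('m, 'v) conn"
    and h :: "'m \<Rightarrow> 'm tvec \<Rightarrow> 'm tvec \<Rightarrow> 'v"
    and J :: "'m \<Rightarrow> 'm tvec \<times> 'v \<Rightarrow> 'm tvec \<times> 'v"
    and Rt :: "'m \<Rightarrow> 'm tvec \<times> 'v \<Rightarrow> 'm tvec \<times> 'v \<Rightarrow> 'm tvec \<times> 'v \<Rightarrow> 'm tvec \<times> 'v \<Rightarrow> real"
  assumes "lorentz_surface M g"
    and "levi_civita M g nab"
    and "lorentzian_kaehler_surface_data M g nab N T gN D h J Rt"
    and "gauss_equation M g nab gN h Rt"
    and "codazzi_equation M g nab N gN D h Rt"
  shows "ricci_equation M g N T gN D h Rt"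
proof -
  interpret lorentzian_kaehler_surface M g nab N T gN D h J Rt
    by unfold_locales (fact assms)+
  show ?thesis
    by (rule gauss_codazzi_imp_ricci) (fact assms)+
qed

end
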